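(* Let $Q$ be a spider web quiver with three circles, with middle-circle vertices $1,\dots,n$, and consider the seed with cluster variables $x_v$ at the vertices $v$ of $Q$. Let $$\overline{x}=\frac{\sum_{j=1}^{n-1}\left(\left(\prod_{k=1}^{j-1}x_k\right)\left(\prod_{k=j+2}^{n}x_k\right)x_{[j]^-_*}x_{[j]^+_*}\right)+\left(\prod_{k=2}^{n-1}x_k\right)x_{[n]^-}x_{[n]^+}}{\prod_{k=1}^n x_k}.$$ Then applying $\tau=\mu_1\mu_2\cdots\mu_{n-2}s_{n-1,n}\mu_n\mu_{n-1}\cdots\mu_1$ gives $\tau(x_i)=x_i\overline{x}$ for each middle-circle vertex $i\in\{1,\dots,n\}$.
   Context: A quiver: directed graph, no loops or 2-cycles. Seed mutation at $k$: the quiver mutates ($i\to k\to j$ gives a new arrow $i\to j$, arrows at $k$ reversed, 2-cycles removed) and the cluster variable $x_k$ is replaced by $x_k'=\big(\prod_j x_j^{\#\{k\to j\}}+\prod_j x_j^{\#\{j\to k\}}\big)/x_k$, other variables unchanged. $s_{n-1,n}$ transposes vertices $n-1,n$ (together with their variables); $\tau$ is applied with the rightmost operation first. Spider web quiver: concentric circles (here three), each with at least 2 vertices, circle edges oriented counterclockwise, plus arrows between adjacent circles so that every face is a directed cycle with exactly two arrows between circles and at least 3 sides. Middle-circle vertices are labeled $1,\dots,n$ following the arrows. If $i$ is the lowest-index middle vertex with an arrow to/from the outer circle, the outer vertex with an arrow to $i$ is $1^-$, and the outer circle continues $2^-,3^-,\dots$ following the arrows; inner circle vertices $1^+,2^+,\dots$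 are labeled likewise. "Largest" on the outer/inner circle refers to this labeling. Let $\alpha$ (resp. $\beta$) be the largest outer (resp. inner) circle vertex connected to the middle circle. Define $x_{[i]^-}=x_a$ if some outer vertex has an edge to an element of $\{1,\dots,i\}$ and $a$ is the largest such vertex, and $x_{[i]^-}=1$ otherwise; $x_{[i]^+}$ likewise with the inner circle. Define $x_{[i]^-_*}$, $x_{[i]^+_*}$ in the same way except that in the "otherwise" case they equal $x_\alpha$, resp. $x_\beta$. *)

theory Defs
  imports
    Complex_Main
    "HOL-Library.Poly_Mapping"
    "HOL-Computational_Algebra.Fraction_Field"
    "HOL-Combinatorics.Transposition"
begin

section \<open>Quivers, seeds and mutation\<close>

text \<open>A quiver is stored through its finite vertex set and the number of arrows
  between any two vertices.\<close>

record 'v quiver =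
  verts :: "'v set"
  arrows :: "'v \<Rightarrow> 'v \<Rightarrow> nat"

definition no_loops_or_2_cycles :: "('v, 'b) quiver_scheme \<Rightarrow> bool" where
  "no_loops_or_2_cycles Q \<longleftrightarrow>
     (\<forall>u. arrows Q u u = 0) \<and> (\<forall>u v. arrows Q u v = 0 \<or> arrows Q v u = 0)"

text \<open>Removal of a maximal collection of 2-cycles; the subtraction is the truncated
  one on \<open>nat\<close>.\<close>

definition remove_2_cycles :: "('v \<Rightarrow> 'v \<Rightarrow> nat) \<Rightarrow> 'v \<Rightarrow> 'v \<Rightarrow> nat" where
  "remove_2_cycles c u v = c u v - c v u"

definition mutate_quiver :: "'v \<Rightarrow> 'v quiver \<Rightarrow> 'v quiver" where
  "mutate_quiver k Q = Q\<lparr>arrows := remove_2_cycles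
     (\<lambda>i j. if i = k \<or> j = k then arrows Q j i
            else arrows Q i j + arrows Q i k * arrows Q k j)\<rparr>"

record ('v, 'f) seed =
  quiver :: "'v quiver"
  cvar :: "'v \<Rightarrow> 'f"

definition mutate :: "'v \<Rightarrow> ('v, 'f::field) seed \<Rightarrow> ('v, 'f) seed" where
  "mutate k s =
    \<lparr>quiver = mutate_quiver k (quiver s),
     cvar = (cvar s)(k :=
       ((\<Prod>j\<in>verts (quiver s). cvar s j ^ arrows (quiver s) k j) +
        (\<Prod>j\<in>verts (quiver s). cvar s j ^ arrows (quiver s) j k)) / cvar s k)\<rparr>"

definition swap_vertices :: "'v \<Rightarrow> 'v \<Rightarrow> ('v, 'f) seed \<Rightarrow> ('v, 'f) seed" where
  "swap_vertices a b s =
    \<lparr>quiver = \<lparr>verts = transpose a b ` verts (quiver s),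
               arrows = (\<lambda>u v. arrows (quiver s) (transpose a b u) (transpose a b v))\<rparr>,
     cvar = (\<lambda>v. cvar s (transpose a b v))\<rparr>"

lemma no_loops_or_2_cycles_mutate:
  "no_loops_or_2_cycles (mutate_quiver k Q)"
  by (auto simp: no_loops_or_2_cycles_def mutate_quiver_def remove_2_cycles_def)


section \<open>Spider web quivers with three circles\<close>

text \<open>\<open>Outer a\<close>, \<open>Middle i\<close>, \<open>Inner b\<close> stand for the vertices written
  $a^-$, $i$, $b^+$; labels start at 1.\<close>

datatype web_vertex = Outer nat | Middle nat | Inner nat

text \<open>A \<^emph>\<open>spoke\<close> is an arrow between two adjacent circles. Its ends are recorded by
  their labels on the outer and on the inner one of these two circles, together with
  its direction.\<close>

record spoke =
  outer_end :: nat
  inner_end :: nat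
  inward :: bool

text \<open>Number of circle arrows on the path from \<open>a\<close> to \<open>b\<close> that follows the arrows of a
  circle with \<open>N\<close> vertices (labelled \<open>1, \<dots>, N\<close> along the arrows).\<close>

definition arc :: "nat \<Rightarrow> nat \<Rightarrow> nat \<Rightarrow> nat" where
  "arc N a b = nat ((int b - int a) mod int N)"

text \<open>Let \<open>f\<close> be the spoke that follows \<open>e\<close> counterclockwise. The boundary of the face
  between them, walked counterclockwise, consists of the outer arc from \<open>e\<close> to \<open>f\<close>,
  the spoke \<open>f\<close> walked inwards, the inner arc from \<open>f\<close> back to \<open>e\<close> (walked against its
  arrows, as both circles are oriented counterclockwise) and the spoke \<open>e\<close> walked
  outwards. The list records for each side whether the walk follows the arrow.\<close>

definition face_sides :: "nat \<Rightarrow> nat \<Rightarrow> spoke \<Rightarrow> spoke \<Rightarrow> bool list" where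
  "face_sides p q e f =
     replicate (arc p (outer_end e) (outer_end f)) True @ [inward f] @
     replicate (arc q (inner_end e) (inner_end f)) False @ [\<not> inward e]"

definition directed_cycle_face :: "nat \<Rightarrow> nat \<Rightarrow> spoke \<Rightarrow> spoke \<Rightarrow> bool" where
  "directed_cycle_face p q e f \<longleftrightarrow>
     length (face_sides p q e f) \<ge> 3 \<and>
     ((\<forall>s\<in>set (face_sides p q e f). s) \<or> (\<forall>s\<in>set (face_sides p q e f). \<not> s))"

text \<open>The list \<open>S\<close> contains the spokes between circles with \<open>p\<close> (outer) and \<open>q\<close> (inner)
  vertices in counterclockwise cyclic order. As spokes do not cross, the faces of the
  annulus are the regions between consecutive spokes, so each has exactly two spokes
  on its boundary; planarity says that the arcs on these faces run around either
  circle exactly once. A directed cycle does not revisit a vertex, so each of its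
  arcs is shorter than the full circle and hence given by \<open>arc\<close>.\<close>

definition web_annulus :: "nat \<Rightarrow> nat \<Rightarrow> spoke list \<Rightarrow> bool" where
  "web_annulus p q S \<longleftrightarrow>
     (let nxt = (\<lambda>k. Suc k mod length S) in
       (\<forall>e\<in>set S. outer_end e \<in> {1..p} \<and> inner_end e \<in> {1..q}) \<and>
       (\<Sum>k<length S. arc p (outer_end (S ! k)) (outer_end (S ! nxt k))) = p \<and>
       (\<Sum>k<length S. arc q (inner_end (S ! k)) (inner_end (S ! nxt k))) = q \<and>
       (\<forall>k<length S. directed_cycle_face p q (S ! k) (S ! nxt k)))"

definition circle_arrows :: "nat \<Rightarrow> nat \<Rightarrow> nat \<Rightarrow> nat" where
  "circle_arrows N a b = of_bool (a \<in> {1..N} \<and> b = (if a = N then 1 else Suc a))"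

definition inward_arrows :: "spoke list \<Rightarrow> nat \<Rightarrow> nat \<Rightarrow> nat" where
  "inward_arrows S a b =
     length (filter (\<lambda>e. outer_end e = a \<and> inner_end e = b \<and> inward e) S)"

definition outward_arrows :: "spoke list \<Rightarrow> nat \<Rightarrow> nat \<Rightarrow> nat" where
  "outward_arrows S b a =
     length (filter (\<lambda>e. outer_end e = a \<and> inner_end e = b \<and> \<not> inward e) S)"

fun web_arrows :: "nat \<Rightarrow> nat \<Rightarrow> nat \<Rightarrow> spoke list \<Rightarrow> spoke list \<Rightarrow>
    web_vertex \<Rightarrow> web_vertex \<Rightarrow> nat" where
  "web_arrows p n q S T (Outer a) (Outer b) = circle_arrows p a b"
| "web_arrows p n q S T (Middle a) (Middle b) = circle_arrows n a b"
| "web_arrows p n q S T (Inner a) (Inner b) = circle_arrows q a b"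
| "web_arrows p n q S T (Outer a) (Middle b) = inward_arrows S a b"
| "web_arrows p n q S T (Middle b) (Outer a) = outward_arrows S b a"
| "web_arrows p n q S T (Middle a) (Inner b) = inward_arrows T a b"
| "web_arrows p n q S T (Inner b) (Middle a) = outward_arrows T b a"
| "web_arrows p n q S T (Outer a) (Inner b) = 0"
| "web_arrows p n q S T (Inner b) (Outer a) = 0"

text \<open>A circle with exactly two vertices is drawn with one arrow in each direction;
  this 2-cycle cancels in the quiver.\<close>

definition web_quiver ::
    "nat \<Rightarrow> nat \<Rightarrow> nat \<Rightarrow> spoke list \<Rightarrow> spoke list \<Rightarrow> web_vertex quiver" where
  "web_quiver p n q S T =
    \<lparr>verts = Outer ` {1..p} \<union> Middle ` {1..n} \<union> Inner ` {1..q},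
     arrows = remove_2_cycles (web_arrows p n q S T)\<rparr>"

lemma no_loops_or_2_cycles_web_quiver:
  "no_loops_or_2_cycles (web_quiver p n q S T)"
  by (auto simp: no_loops_or_2_cycles_def web_quiver_def remove_2_cycles_def)

definition adjacent :: "'v quiver \<Rightarrow> 'v \<Rightarrow> 'v \<Rightarrow> bool" where
  "adjacent Q u v \<longleftrightarrow> arrows Q u v > 0 \<or> arrows Q v u > 0"

text \<open>\<open>circ\<close> is \<open>Outer\<close> or \<open>Inner\<close>: the vertex of that circle with an arrow to the lowest
  middle vertex connected to the circle carries label 1.\<close>

definition well_labelled :: "nat \<Rightarrow> web_vertex quiver \<Rightarrow> (nat \<Rightarrow> web_vertex) \<Rightarrow> bool" where
  "well_labelled n Q circ \<longleftrightarrow>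
     arrows Q (circ 1)
       (Middle (LEAST i. i \<in> {1..n} \<and> (\<exists>a. adjacent Q (circ a) (Middle i)))) > 0"

text \<open>\<open>n\<close> is the number of vertices on the middle circle.\<close>

definition spider_web_quiver :: "nat \<Rightarrow> web_vertex quiver \<Rightarrow> bool" where
  "spider_web_quiver n Q \<longleftrightarrow>
     (\<exists>p q S T. p \<ge> 2 \<and> n \<ge> 2 \<and> q \<ge> 2 \<and>
        web_annulus p n S \<and> web_annulus n q T \<and>
        Q = web_quiver p n q S T) \<and>
     well_labelled n Q Outer \<and> well_labelled n Q Inner"


section \<open>The field of rational functions in the initial cluster variables\<close>

text \<open>The linear order on the variables has no mathematical significance: the
  \<open>idom\<close> instance for polynomials in \<open>Poly_Mapping\<close> asks for one.\<close>

fun vertex_key :: "web_vertex \<Rightarrow> nat" where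
  "vertex_key (Outer a) = 3 * a"
| "vertex_key (Middle a) = 3 * a + 1"
| "vertex_key (Inner a) = 3 * a + 2"

lemma vertex_key_inject: "vertex_key u = vertex_key v \<Longrightarrow> u = v"
  by (cases u; cases v; simp; presburger?)

instantiation web_vertex :: linorder
begin

definition less_eq_web_vertex :: "web_vertex \<Rightarrow> web_vertex \<Rightarrow> bool" where
  "less_eq_web_vertex u v \<longleftrightarrow> vertex_key u \<le> vertex_key v"

definition less_web_vertex :: "web_vertex \<Rightarrow> web_vertex \<Rightarrow> bool" where
  "less_web_vertex u v \<longleftrightarrow> vertex_key u < vertex_key v"

instance
  by standard
    (auto simp: less_eq_web_vertex_def less_web_vertex_def intro: vertex_key_inject)

end

text \<open>\<open>web_vertex \<Rightarrow>\<^sub>0 nat\<close> are the monomials, so this is the fraction field of the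
  polynomial ring over the rationals with one variable per vertex.\<close>

type_synonym ratfun = "((web_vertex \<Rightarrow>\<^sub>0 nat) \<Rightarrow>\<^sub>0 rat) fract"

definition X :: "web_vertex \<Rightarrow> ratfun" where
  "X v = Fract (Poly_Mapping.single (Poly_Mapping.single v 1) 1) 1"

definition initial_seed :: "web_vertex quiver \<Rightarrow> (web_vertex, ratfun) seed" where
  "initial_seed Q = \<lparr>quiver = Q, cvar = X\<rparr>"


section \<open>The transformation \<open>\<tau>\<close> and the element \<open>xbar\<close>\<close>

definition tau :: "nat \<Rightarrow> (web_vertex, 'f::field) seed \<Rightarrow> (web_vertex, 'f) seed" where
  "tau n s =
     fold mutate (map Middle (rev [1..<n - 1]))
       (swap_vertices (Middle (n - 1)) (Middle n)
         (fold mutate (map Middle [1..<n + 1]) s))"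

definition largest_connected ::
    "nat \<Rightarrow> web_vertex quiver \<Rightarrow> (nat \<Rightarrow> web_vertex) \<Rightarrow> nat" where
  "largest_connected n Q circ =
     Max {a. \<exists>j\<in>{1..n}. adjacent Q (circ a) (Middle j)}"

text \<open>The labels of the vertices on the circle \<open>circ\<close> with an arrow to one of the middle
  vertices \<open>1, \<dots>, i\<close> (arrows in the opposite direction do not count).\<close>

definition sources_to :: "web_vertex quiver \<Rightarrow> (nat \<Rightarrow> web_vertex) \<Rightarrow> nat \<Rightarrow> nat set" where
  "sources_to Q circ i = {a. \<exists>j\<in>{1..i}. arrows Q (circ a) (Middle j) > 0}"

text \<open>$x_{[i]^-}$ and $x_{[i]^+}$ for \<open>circ = Outer\<close> and \<open>circ = Inner\<close>, and their starred
  variants.\<close>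

definition x_br :: "web_vertex quiver \<Rightarrow> (web_vertex \<Rightarrow> 'f::field) \<Rightarrow>
    (nat \<Rightarrow> web_vertex) \<Rightarrow> nat \<Rightarrow> 'f" where
  "x_br Q x circ i =
     (if sources_to Q circ i \<noteq> {} then x (circ (Max (sources_to Q circ i))) else 1)"

definition x_br_star :: "nat \<Rightarrow> web_vertex quiver \<Rightarrow> (web_vertex \<Rightarrow> 'f::field) \<Rightarrow>
    (nat \<Rightarrow> web_vertex) \<Rightarrow> nat \<Rightarrow> 'f" where
  "x_br_star n Q x circ i =
     (if sources_to Q circ i \<noteq> {} then x (circ (Max (sources_to Q circ i)))
      else x (circ (largest_connected n Q circ)))"

definition xbar :: "nat \<Rightarrow> web_vertex quiver \<Rightarrow> (web_vertex \<Rightarrow> 'f::field) \<Rightarrow> 'f" where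
  "xbar n Q x =
     ((\<Sum>j=1..n-1. (\<Prod>k=1..j-1. x (Middle k)) * (\<Prod>k=j+2..n. x (Middle k)) *
          x_br_star n Q x Outer j * x_br_star n Q x Inner j) +
      (\<Prod>k=2..n-1. x (Middle k)) * x_br Q x Outer n * x_br Q x Inner n) /
     (\<Prod>k=1..n. x (Middle k))"

end

(* Only the signed adjacency columns at middle vertices matter. A face between two circles that
   contains the middle arrow j -> j + 1 has a unique corner w j on the other circle, and the column
   of the quiver at j is (w j) - (w (j - 1)). After mutating at 1, ..., n - 2, the vertices n - 1
   and n have opposite columns, so that mutating at both and swapping them restores the quiver;
   the remaining mutations undo the first ones. Up to frozen factors the exchange relations on the
   way forth are x_k u_k = x_n W_k + x_(k+1) u_(k-1) with W_k the product of the corners at k,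
   which telescopes to u_k / x_(k+1) = x_n (sum_(j<=k) W_j / (x_j x_(j+1))) + W_0 / x_1, and
   scales x_(n-1) and x_n by xbar. The relations on the way back are the same ones with the right
   hand side scaled by xbar. Division by u_k is legitimate because u_k is subtraction-free. *)

theory Submission
  imports Defs
begin

section \<open>The signed adjacency matrix\<close>

text \<open>The skew-symmetric exchange matrix of cluster theory. Removing 2-cycles leaves it
  unchanged, so its mutation rule needs no truncated subtraction.\<close>

definition bmat :: "('v, 'b) quiver_scheme \<Rightarrow> 'v \<Rightarrow> 'v \<Rightarrow> int" where
  "bmat Q u v = int (arrows Q u v) - int (arrows Q v u)"

lemma bmat_antisym: "bmat Q u v = - bmat Q v u"
  by (simp add: bmat_def)

lemma bmat_self [simp]: "bmat Q v v = 0"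
  by (simp add: bmat_def)

lemma arrows_eq_bmat:
  assumes "no_loops_or_2_cycles Q"
  shows "arrows Q u v = nat (bmat Q u v)"
proof -
  have "arrows Q u v = 0 \<or> arrows Q v u = 0"
    using assms by (auto simp: no_loops_or_2_cycles_def)
  then show ?thesis by (auto simp: bmat_def)
qed

lemma quiver_eqI:
  fixes Q R :: "'v quiver"
  assumes "no_loops_or_2_cycles Q" "no_loops_or_2_cycles R" "verts Q = verts R"
    and "\<And>u v. bmat Q u v = bmat R u v"
  shows "Q = R"
proof -
  have "arrows Q = arrows R"
    using assms by (auto simp: fun_eq_iff arrows_eq_bmat)
  then show ?thesis using assms(3) by (cases Q; cases R) simp
qed

lemma verts_mutate_quiver [simp]: "verts (mutate_quiver k Q) = verts Q"
  by (simp add: mutate_quiver_def)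

lemma bmat_mutate_quiver:
  assumes "no_loops_or_2_cycles Q"
  shows "bmat (mutate_quiver k Q) u v =
    (if u = k \<or> v = k then - bmat Q u v
     else bmat Q u v + (max 0 (bmat Q u k) * max 0 (bmat Q k v)
                        - max 0 (bmat Q v k) * max 0 (bmat Q k u)))"
proof -
  have r: "int (remove_2_cycles c u v) - int (remove_2_cycles c v u) = int (c u v) - int (c v u)"
    for c by (simp add: remove_2_cycles_def of_nat_diff split: nat_diff_split)
  have a: "int (arrows Q x y) = max 0 (bmat Q x y)" for x y
    using arrows_eq_bmat[OF assms] by simp
  show ?thesis
    unfolding a[symmetric] unfolding bmat_def mutate_quiver_def by (simp add: r)
qed

text \<open>Mutation negates row and column \<open>k\<close>, which exchanges the paths u -> k -> v
  with the paths v -> k -> u; hence the second correction undoes the first.\<close>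

lemma mutate_quiver_involution:
  assumes Q: "no_loops_or_2_cycles Q"
  shows "mutate_quiver k (mutate_quiver k Q) = Q"
proof (rule quiver_eqI[OF no_loops_or_2_cycles_mutate Q])
  fix u v
  have s: "bmat Q k u = - bmat Q u k" "bmat Q k v = - bmat Q v k" by (rule bmat_antisym)+
  show "bmat (mutate_quiver k (mutate_quiver k Q)) u v = bmat Q u v"
    unfolding bmat_mutate_quiver[OF no_loops_or_2_cycles_mutate] bmat_mutate_quiver[OF Q]
    by (auto simp: s)
qed simp

definition swap_quiver :: "'v \<Rightarrow> 'v \<Rightarrow> 'v quiver \<Rightarrow> 'v quiver" where
  "swap_quiver a b Q = \<lparr>verts = transpose a b ` verts Q,
               arrows = (\<lambda>u v. arrows Q (transpose a b u) (transpose a b v))\<rparr>"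

text \<open>The contributions of the two mutations to the arrows between other vertices cancel.\<close>

lemma swap_mutate_opposite_twins:
  assumes Q: "no_loops_or_2_cycles Q" and ab: "a \<noteq> b" "a \<in> verts Q" "b \<in> verts Q"
    and opp: "\<And>v. bmat Q v b = - bmat Q v a"
  shows "swap_quiver a b (mutate_quiver b (mutate_quiver a Q)) = Q"
proof (rule quiver_eqI)
  have n: "no_loops_or_2_cycles (mutate_quiver b (mutate_quiver a Q))"
    by (rule no_loops_or_2_cycles_mutate)
  then show "no_loops_or_2_cycles (swap_quiver a b (mutate_quiver b (mutate_quiver a Q)))"
    by (simp add: no_loops_or_2_cycles_def swap_quiver_def)
  have "transpose a b ` verts Q = verts Q"
    using ab by (auto simp: transpose_def image_iff split: if_splits)
  then show "verts (swap_quiver a b (mutate_quiver b (mutate_quiver a Q))) = verts Q"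
    by (simp add: swap_quiver_def)
  fix u v
  let ?t = "transpose a b"
  have opp': "bmat Q b w = - bmat Q a w" for w
    using opp[of w] bmat_antisym[of Q a w] bmat_antisym[of Q b w] by simp
  \<comment> \<open>Opposite columns and the zero diagonal exclude arrows between \<open>a\<close>
    and \<open>b\<close>, so the mutation at \<open>a\<close> leaves column \<open>b\<close>
    unchanged.\<close>
  have z: "bmat Q a b = 0" "bmat Q b a = 0"
    using opp[of a] opp'[of a] by auto
  have s: "bmat Q a w = - bmat Q w a" for w by (rule bmat_antisym)
  have "bmat (swap_quiver a b (mutate_quiver b (mutate_quiver a Q))) u v
      = bmat (mutate_quiver b (mutate_quiver a Q)) (?t u) (?t v)"
    by (simp add: bmat_def swap_quiver_def)
  also have "\<dots> = bmat Q u v"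
    unfolding bmat_mutate_quiver[OF no_loops_or_2_cycles_mutate] bmat_mutate_quiver[OF Q]
    using ab(1) by (auto simp: transpose_def opp opp' z s[of u] s[of v])
  finally show "bmat (swap_quiver a b (mutate_quiver b (mutate_quiver a Q))) u v = bmat Q u v" .
qed (rule Q)

section \<open>Annuli of a spider web\<close>

lemma arc_eq:
  assumes "a \<in> {1..N}" "b \<in> {1..N}"
  shows "arc N a b = (if a \<le> b then b - a else N + b - a)"
proof (cases "a \<le> b")
  case True
  then have "(int b - int a) mod int N = int b - int a"
    using assms by (intro mod_pos_pos_trivial) auto
  then show ?thesis using True by (simp add: arc_def nat_diff_distrib)
next
  case False
  have "(int b - int a) mod int N = (int b - int a + int N) mod int N" by simp
  also have "\<dots> = int b - int a + int N"
    using False assms by (intro mod_pos_pos_trivial) auto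
  finally show ?thesis using False by (simp add: arc_def)
qed

lemma arc_self [simp]: "arc N a a = 0"
  by (simp add: arc_def)

lemma arc_eq_0_iff: "a \<in> {1..N} \<Longrightarrow> b \<in> {1..N} \<Longrightarrow> arc N a b = 0 \<longleftrightarrow> a = b"
  by (auto simp: arc_eq)

lemma arc_less: "a \<in> {1..N} \<Longrightarrow> b \<in> {1..N} \<Longrightarrow> arc N a b < N"
  by (auto simp: arc_eq)

lemma card_arc_less:
  assumes "a \<in> {1..N}" "m \<le> N"
  shows "card {j \<in> {1..N}. arc N a j < m} = m"
proof -
  \<comment> \<open>From \<open>a\<close> the labels run up to \<open>N\<close> and then wrap around
    to 1.\<close>
  have "{j \<in> {1..N}. arc N a j < m} = {a..<min (a + m) (N + 1)} \<union> {1..<a + m - N}"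
    using assms by (auto simp: arc_eq split: if_splits; arith)
  moreover have "card ({a..<min (a + m) (N + 1)} \<union> {1..<a + m - N})
     = card {a..<min (a + m) (N + 1)} + card {1..<a + m - N}"
    using assms by (intro card_Un_disjoint) auto
  ultimately show ?thesis using assms by auto
qed

definition cpred :: "nat \<Rightarrow> nat \<Rightarrow> nat" where
  "cpred N j = (if j = 1 then N else j - 1)"

lemma cpred_in: "j \<in> {1..N} \<Longrightarrow> cpred N j \<in> {1..N}"
  by (auto simp: cpred_def)

text \<open>The arc from \<open>a\<close> to \<open>b\<close> covers the circle arrow leaving \<open>j\<close> iff \<open>arc N a j < arc N a b\<close>.\<close>

lemma arc_covers_diff:
  assumes "a \<in> {1..N}" "b \<in> {1..N}" "j \<in> {1..N}"
  shows "of_bool (arc N a j < arc N a b) - of_bool (arc N a (cpred N j) < arc N a b)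
     = (of_bool (a = j) - of_bool (b = j) :: int)"
proof -
  have j': "cpred N j \<in> {1..N}" by (rule cpred_in[OF assms(3)])
  \<comment> \<open>The predecessor of the starting point has the largest distance
    \<open>N - 1\<close>, which no arc covers. Elsewhere the distance grows by one at
    \<open>j\<close>, so coverage changes only at the end \<open>b\<close>.\<close>
  have N: "arc N a (cpred N j) = N - 1" if "a = j"
    using assms that unfolding arc_eq[OF assms(1) j'] by (auto simp: cpred_def)
  have S: "arc N a j = Suc (arc N a (cpred N j))" if "a \<noteq> j"
    using assms that unfolding arc_eq[OF assms(1) j'] arc_eq[OF assms(1,3)]
    by (auto simp: cpred_def)
  have inj: "arc N a j = arc N a b \<longleftrightarrow> b = j"
    using assms unfolding arc_eq[OF assms(1,2)] arc_eq[OF assms(1,3)] by auto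
  have lt: "arc N a b < N" by (rule arc_less[OF assms(1,2)])
  show ?thesis
  proof (cases "a = j")
    case True
    then show ?thesis using N[OF True] lt arc_eq_0_iff[OF assms(1,2)] by auto
  next
    case False
    then show ?thesis using S[OF False] inj by auto
  qed
qed

text \<open>On the counterclockwise walk the outer arc follows its arrows and the inner arc opposes
  them, so in an oriented face one of the two is trivial. Three sides mean two spokes and at least
  one circle arrow.\<close>

lemma directed_cycle_face_iff:
  "directed_cycle_face p q e f \<longleftrightarrow>
     arc p (outer_end e) (outer_end f) + arc q (inner_end e) (inner_end f) \<ge> 1 \<and>
     (if inward e then \<not> inward f \<and> arc p (outer_end e) (outer_end f) = 0
      else inward f \<and> arc q (inner_end e) (inner_end f) = 0)"
proof -
  have "(\<forall>s\<in>set (replicate x True @ [b] @ replicate y False @ [\<not> c]). s) \<longleftrightarrow> b \<and> y = 0 \<and> \<not> c"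
    "(\<forall>s\<in>set (replicate x True @ [b] @ replicate y False @ [\<not> c]). \<not> s) \<longleftrightarrow> \<not> b \<and> x = 0 \<and> c"
    for x y b c by (cases x; cases y; auto)+
  then show ?thesis
    unfolding directed_cycle_face_def face_sides_def by (simp del: set_append)
qed

section \<open>The face across each middle arrow\<close>

locale annulus =
  fixes p n :: nat and S :: "spoke list"
  assumes annulus: "web_annulus p n S" and p: "p > 0" and n: "n > 0"
begin

definition out_v where "out_v k = outer_end (S ! k)"
definition in_v where "in_v k = inner_end (S ! k)"
definition dir where "dir k = inward (S ! k)"
definition nxt where "nxt k = Suc k mod length S"
text \<open>Expresses that the face between spoke \<open>k\<close> and its successor contains the
  circle arrow leaving \<open>j\<close>.\<close>

definition covers where "covers k j \<longleftrightarrow> arc n (in_v k) j < arc n (in_v k) (in_v (nxt k))"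

lemma out_v_in: "k < length S \<Longrightarrow> out_v k \<in> {1..p}"
  and in_v_in: "k < length S \<Longrightarrow> in_v k \<in> {1..n}"
  using annulus by (auto simp: web_annulus_def out_v_def in_v_def Let_def)

lemma sum_out: "(\<Sum>k<length S. arc p (out_v k) (out_v (nxt k))) = p"
  and sum_in: "(\<Sum>k<length S. arc n (in_v k) (in_v (nxt k))) = n"
  using annulus by (auto simp: web_annulus_def out_v_def in_v_def nxt_def Let_def)

lemma nonempty: "length S > 0"
  using sum_out p by (cases "length S") auto

lemma nxt_less [simp]: "nxt k < length S"
  using nonempty by (simp add: nxt_def)

lemma bij_nxt: "bij_betw nxt {..<length S} {..<length S}"
proof -
  have "inj_on nxt {..<length S}"
    by (auto simp: inj_on_def nxt_def mod_Suc split: if_splits)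
  then show ?thesis
    by (simp add: bij_betw_def endo_inj_surj image_subset_iff)
qed

lemma nxt_inj: "k < length S \<Longrightarrow> l < length S \<Longrightarrow> nxt k = nxt l \<Longrightarrow> k = l"
  using bij_nxt by (auto simp: bij_betw_def inj_on_def)

lemma nxt_surj:
  assumes "k < length S" obtains l where "l < length S" "nxt l = k"
  using bij_nxt assms by (auto simp: bij_betw_def) (metis imageE lessThan_iff)

lemma sum_nxt: "(\<Sum>k<length S. g (nxt k)) = (\<Sum>k<length S. g k)"
  for g :: "nat \<Rightarrow> 'a::comm_monoid_add"
  by (rule sum.reindex_bij_betw[OF bij_nxt])

lemma face: "k < length S \<Longrightarrow> directed_cycle_face p n (S ! k) (S ! nxt k)"
  using annulus by (auto simp: web_annulus_def nxt_def Let_def)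

text \<open>With an inward first spoke the outer arc is trivial, so all circle arrows of the face
  lie on the inner circle and its only outer vertex is a corner.\<close>

lemma face_inward:
  assumes k: "k < length S" and d: "dir k"
  shows "\<not> dir (nxt k)" "out_v (nxt k) = out_v k" "in_v (nxt k) \<noteq> in_v k"
proof -
  have *: "arc p (out_v k) (out_v (nxt k)) + arc n (in_v k) (in_v (nxt k)) \<ge> 1"
    "\<not> dir (nxt k)" "arc p (out_v k) (out_v (nxt k)) = 0"
    using face[OF k] d by (simp_all add: directed_cycle_face_iff out_v_def in_v_def dir_def)
  show "\<not> dir (nxt k)" by (rule *)
  show "out_v (nxt k) = out_v k"
    using *(3) arc_eq_0_iff[OF out_v_in[OF k] out_v_in[OF nxt_less]] by simp
  show "in_v (nxt k) \<noteq> in_v k" using * by auto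
qed

lemma face_outward:
  assumes k: "k < length S" and d: "\<not> dir k"
  shows "dir (nxt k)" "in_v (nxt k) = in_v k"
proof -
  have *: "dir (nxt k)" "arc n (in_v k) (in_v (nxt k)) = 0"
    using face[OF k] d by (simp_all add: directed_cycle_face_iff in_v_def dir_def)
  show "dir (nxt k)" by (rule *)
  show "in_v (nxt k) = in_v k"
    using *(2) arc_eq_0_iff[OF in_v_in[OF k] in_v_in[OF nxt_less]] by simp
qed

lemma covers_diff:
  assumes "k < length S" "j \<in> {1..n}"
  shows "of_bool (covers k j) - of_bool (covers k (cpred n j))
     = (of_bool (in_v k = j) - of_bool (in_v (nxt k) = j) :: int)"
  using arc_covers_diff[OF in_v_in[OF assms(1)] in_v_in[OF nxt_less] assms(2)]
  by (simp add: covers_def)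

lemma covers_inward: "k < length S \<Longrightarrow> covers k j \<Longrightarrow> dir k"
  using face_outward(2)[of k] by (cases "dir k") (auto simp: covers_def)

text \<open>By \<open>covers_diff\<close> the number of arcs that cover \<open>j\<close> does not depend on \<open>j\<close>; it is 1 because
  the lengths of the arcs add up to \<open>n\<close>.\<close>

lemma card_covers:
  assumes "j \<in> {1..n}"
  shows "card {k \<in> {..<length S}. covers k j} = 1"
proof -
  define cv :: "nat \<Rightarrow> int" where "cv j = (\<Sum>k<length S. of_bool (covers k j))" for j
  have pred: "cv j = cv (cpred n j)" if "j \<in> {1..n}" for j
  proof -
    have "cv j - cv (cpred n j) = (\<Sum>k<length S. of_bool (in_v k = j) - of_bool (in_v (nxt k) = j))"
      unfolding cv_def sum_subtractf[symmetric] using that by (intro sum.cong) (auto simp: covers_diff)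
    also have "\<dots> = 0"
      using sum_nxt[of "\<lambda>k. of_bool (in_v k = j) :: int"] by (simp add: sum_subtractf)
    finally show ?thesis by simp
  qed
  have const: "cv j = cv 1" if "1 \<le> j" "j \<le> n" for j
    using that
  proof (induction j rule: dec_induct)
    case (step j)
    then show ?case using pred[of "Suc j"] by (simp add: cpred_def)
  qed simp
  \<comment> \<open>Double counting of the pairs of a face and a circle arrow on it.\<close>
  have "int n * cv 1 = (\<Sum>j\<in>{1..n}. cv j)"
    using sum_constant[of "cv 1" "{1..n}"] sum.cong[OF refl, of "{1..n}" cv "\<lambda>_. cv 1"] const
    by (metis (no_types, lifting) atLeastAtMost_iff card_atLeastAtMost diff_Suc_1)
  also have "\<dots> = (\<Sum>k<length S. \<Sum>j\<in>{1..n}. of_bool (covers k j))"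
    unfolding cv_def by (rule sum.swap)
  also have "\<dots> = (\<Sum>k<length S. int (arc n (in_v k) (in_v (nxt k))))"
  proof (rule sum.cong)
    fix k assume "k \<in> {..<length S}"
    then have k: "in_v k \<in> {1..n}" using in_v_in by simp
    have "(\<Sum>j\<in>{1..n}. of_bool (covers k j)) = int (card {j \<in> {1..n}. covers k j})"
      by (simp add: sum.If_cases of_bool_def Int_def)
    then show "(\<Sum>j\<in>{1..n}. of_bool (covers k j)) = int (arc n (in_v k) (in_v (nxt k)))"
      using card_arc_less[OF k less_imp_le[OF arc_less[OF k in_v_in[OF nxt_less]]]]
      by (simp add: covers_def)
  qed simp
  also have "\<dots> = int n"
    by (simp only: of_nat_sum[symmetric] sum_in)
  finally have "cv 1 = 1" using n by simp
  then have "cv j = 1" using const[of j] assms by auto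
  then show ?thesis
    by (simp add: cv_def sum.If_cases of_bool_def Int_def)
qed

definition cover where "cover j = (THE k. k < length S \<and> covers k j)"

lemma cover_props:
  assumes "j \<in> {1..n}"
  shows "cover j < length S" "covers (cover j) j"
    and "\<And>k. k < length S \<Longrightarrow> covers k j \<Longrightarrow> k = cover j"
proof -
  obtain l where l: "{k \<in> {..<length S}. covers k j} = {l}"
    using card_covers[OF assms] by (auto simp: card_1_singleton_iff)
  then have *: "\<And>k. k < length S \<and> covers k j \<longleftrightarrow> k = l" by auto
  then have "cover j = l" by (simp add: cover_def)
  then show "cover j < length S" "covers (cover j) j"
    "\<And>k. k < length S \<Longrightarrow> covers k j \<Longrightarrow> k = cover j" using * by auto
qed

text \<open>The outer corner of the face that contains the middle arrow \<open>j \<rightarrow> j + 1\<close>; by convention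
  the arrow \<open>n \<rightarrow> 1\<close> also has index 0.\<close>

definition corner where "corner j = out_v (cover (if j = 0 then n else j))"

lemma corner_0: "corner 0 = corner n"
  by (simp add: corner_def)

lemma corner_in: "j \<le> n \<Longrightarrow> corner j \<in> {1..p}"
  using n out_v_in[OF cover_props(1), of "if j = 0 then n else j"]
  by (simp add: corner_def split: if_splits)

lemma corner_pred: "j \<in> {1..n} \<Longrightarrow> corner (j - Suc 0) = out_v (cover (cpred n j))"
  by (auto simp: corner_def cpred_def)

lemma corner_eq: "j \<in> {1..n} \<Longrightarrow> corner j = out_v (cover j)"
  by (simp add: corner_def)

text \<open>An inward spoke \<open>k\<close> and the outward spoke \<open>nxt k\<close> bound a face
  with a single outer vertex. Their joint contribution at \<open>j\<close> is the difference between
  covering the arrow that leaves \<open>j\<close> and covering the one that enters it. After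
  summation only the faces of these two arrows remain.\<close>

lemma spokes_at:
  assumes j: "j \<in> {1..n}"
  shows "int (inward_arrows S a j) - int (outward_arrows S j a)
    = of_bool (a = corner j) - of_bool (a = corner (j - 1))"
proof -
  have cov: "(\<Sum>k<length S. of_bool (out_v k = a) * of_bool (covers k i))
       = (of_bool (out_v (cover i) = a) :: int)" if i: "i \<in> {1..n}" for i
  proof -
    have "(\<Sum>k<length S. of_bool (out_v k = a) * of_bool (covers k i) :: int)
       = (\<Sum>k<length S. if k = cover i then of_bool (out_v (cover i) = a) else 0)"
    proof (rule sum.cong[OF refl])
      fix k assume "k \<in> {..<length S}"
      then have "covers k i \<longleftrightarrow> k = cover i"
        using cover_props(2)[OF i] cover_props(3)[OF i, of k] by blast
      then show "of_bool (out_v k = a) * of_bool (covers k i)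
        = (if k = cover i then of_bool (out_v (cover i) = a) else (0::int))"
        by simp
    qed
    then show ?thesis using cover_props(1)[OF i] by simp
  qed
  define i_at where "i_at k = (of_bool (out_v k = a \<and> in_v k = j \<and> dir k) :: int)" for k
  define o_at where "o_at k = (of_bool (out_v k = a \<and> in_v k = j \<and> \<not> dir k) :: int)" for k
  have "int (inward_arrows S a j) = (\<Sum>k<length S. i_at k)"
    by (simp add: inward_arrows_def length_filter_conv_card i_at_def out_v_def in_v_def dir_def
        sum.If_cases of_bool_def Int_def)
  moreover have "int (outward_arrows S j a) = (\<Sum>k<length S. o_at k)"
    by (simp add: outward_arrows_def length_filter_conv_card o_at_def out_v_def in_v_def dir_def
        sum.If_cases of_bool_def Int_def)
  ultimately have "int (inward_arrows S a j) - int (outward_arrows S j a)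
     = (\<Sum>k<length S. i_at k - o_at (nxt k))"
    using sum_nxt[of o_at] by (simp add: sum_subtractf)
  also have "\<dots> = (\<Sum>k<length S. of_bool (out_v k = a) *
       (of_bool (covers k j) - of_bool (covers k (cpred n j))))"
  proof (rule sum.cong)
    fix k assume "k \<in> {..<length S}"
    then have k: "k < length S" by simp
    show "i_at k - o_at (nxt k) = of_bool (out_v k = a) *
       (of_bool (covers k j) - of_bool (covers k (cpred n j)))"
      unfolding covers_diff[OF k j] i_at_def o_at_def
      using face_inward[OF k] face_outward[OF k] by (cases "dir k") auto
  qed simp
  also have "\<dots> = of_bool (a = corner j) - of_bool (a = corner (j - 1))"
    using cov[OF j] cov[OF cpred_in[OF j]] j
    by (simp add: right_diff_distrib sum_subtractf corner_eq corner_pred eq_commute[of a])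
  finally show ?thesis .
qed

text \<open>An outward spoke is followed by an inward one at the same middle vertex. The faces
  before and after this pair contain the arrows entering and leaving that vertex, so the corner
  moves there from one outer end to the other.\<close>

lemma outward_corners:
  assumes k: "k < length S" and d: "\<not> dir k"
  shows "cover (in_v k) = nxt k" "corner (in_v k) = out_v (nxt k)"
    "corner (in_v k - 1) = out_v k"
proof -
  note j = in_v_in[OF k]
  have "covers (nxt k) (in_v k)"
    using face_outward[OF k d] face_inward(3)[OF nxt_less, of k] in_v_in[OF nxt_less, of k]
      in_v_in[OF nxt_less, of "nxt k"] arc_eq_0_iff
    by (metis arc_self covers_def gr0I)
  then show *: "cover (in_v k) = nxt k" using cover_props(3)[OF j nxt_less] by simp
  then show "corner (in_v k) = out_v (nxt k)" using j by (simp add: corner_eq)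
  obtain l where l: "l < length S" "nxt l = k" using nxt_surj[OF k] .
  then have dl: "dir l" using d face_outward(1) by blast
  have "covers l (cpred n (in_v k))"
    using covers_diff[OF l(1) j] face_inward(3)[OF l(1) dl] l(2)
    by (simp add: of_bool_def split: if_splits)
  then have "cover (cpred n (in_v k)) = l" using cover_props(3)[OF cpred_in[OF j] l(1)] by simp
  then show "corner (in_v k - 1) = out_v k"
    using face_inward(2)[OF l(1) dl] l(2) by (simp add: corner_pred[OF j])
qed

text \<open>The moves of the corner are exactly the outer arcs of the faces that start with an
  outward spoke, and all outer arcs together make one full turn.\<close>

lemma sum_arc_corners: "(\<Sum>j=1..n. arc p (corner (j - 1)) (corner j)) = p"
proof -
  define D where "D = {k. k < length S \<and> \<not> dir k}"
  \<comment> \<open>\<open>outward_corners\<close> recovers \<open>nxt k\<close>, hence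
    \<open>k\<close>, from \<open>in_v k\<close>: a middle vertex has at most one outward
    spoke.\<close>
  have inj: "inj_on in_v D"
    by (intro inj_onI) (metis (mono_tags, lifting) D_def mem_Collect_eq nxt_inj outward_corners(1))
  \<comment> \<open>Without an outward spoke at \<open>j\<close>, the arrows entering and leaving
    \<open>j\<close> lie on one face.\<close>
  have other: "corner j = corner (j - 1)" if j: "j \<in> {1..n}" and nD: "j \<notin> in_v ` D" for j
  proof (cases "covers (cover j) (cpred n j)")
    case True
    then show ?thesis
      using cover_props(3)[OF cpred_in[OF j] cover_props(1)[OF j]] j
      by (simp add: corner_eq corner_pred)
  next
    case False
    note c = cover_props(1,2)[OF j]
    have ij: "in_v (cover j) = j"
      using covers_diff[OF c(1) j] c(2) False by (simp add: of_bool_def split: if_splits)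
    obtain l where l: "l < length S" "nxt l = cover j" using nxt_surj[OF c(1)] .
    have "\<not> dir l" using face_inward(1)[OF l(1)] covers_inward[OF c] l(2) by auto
    then have "j = in_v l" "l \<in> D" using face_outward(2)[OF l(1)] ij l by (auto simp: D_def)
    then show ?thesis using nD by blast
  qed
  have "(\<Sum>j=1..n. arc p (corner (j - 1)) (corner j))
      = (\<Sum>j\<in>in_v ` D. arc p (corner (j - 1)) (corner j))"
    using other in_v_in by (intro sum.mono_neutral_right) (auto simp: D_def)
  also have "\<dots> = (\<Sum>k\<in>D. arc p (corner (in_v k - 1)) (corner (in_v k)))"
    using inj by (simp add: sum.reindex)
  also have "\<dots> = (\<Sum>k\<in>D. arc p (out_v k) (out_v (nxt k)))"
    by (rule sum.cong[OF refl]) (metis (mono_tags, lifting) D_def mem_Collect_eq outward_corners(2,3))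
  also have "\<dots> = (\<Sum>k<length S. arc p (out_v k) (out_v (nxt k)))"
    using face_inward(2) by (intro sum.mono_neutral_left) (auto simp: D_def)
  finally show ?thesis by (simp add: sum_out)
qed

end

text \<open>The function \<open>w\<close> assigns to the middle arrow \<open>j \<rightarrow> j + 1\<close> the label of the vertex across
  it on the adjacent circle.\<close>

definition cyclic_labels :: "nat \<Rightarrow> nat \<Rightarrow> (nat \<Rightarrow> nat) \<Rightarrow> bool" where
  "cyclic_labels p n w \<longleftrightarrow> w 0 = w n \<and> (\<forall>j\<le>n. w j \<in> {1..p}) \<and>
     (\<Sum>j=1..n. arc p (w (j - 1)) (w j)) = p"

lemma web_annulus_labels:
  assumes "web_annulus p n S" "p > 0" "n > 0"
  obtains w where "cyclic_labels p n w"
    "\<And>a j. j \<in> {1..n} \<Longrightarrow> int (inward_arrows S a j) - int (outward_arrows S j a)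
       = of_bool (a = w j) - of_bool (a = w (j - 1))"
proof -
  interpret annulus p n S using assms by unfold_locales
  show thesis
    using that[of corner] spokes_at corner_0 corner_in sum_arc_corners
    by (simp add: cyclic_labels_def)
qed

text \<open>Turns an annulus inside out but keeps the cyclic order of the spokes, so that the
  results for the outer annulus carry over to the inner one.\<close>

definition flip :: "spoke \<Rightarrow> spoke" where
  "flip e = \<lparr>outer_end = inner_end e, inner_end = outer_end e, inward = (\<not> inward e)\<rparr>"

lemma directed_cycle_face_flip:
  "directed_cycle_face p q e f \<Longrightarrow> directed_cycle_face q p (flip e) (flip f)"
  by (auto simp: directed_cycle_face_iff flip_def)

lemma web_annulus_flip:
  assumes "web_annulus p q S"
  shows "web_annulus q p (map flip S)"
proof -
  have m: "Suc k mod length S < length S" if "k < length S" for k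
    using that by (intro mod_less_divisor) auto
  have s: "(\<Sum>k<length S. arc r (g (map flip S ! k)) (g (map flip S ! (Suc k mod length S))))
    = (\<Sum>k<length S. arc r (g (flip (S ! k))) (g (flip (S ! (Suc k mod length S)))))" for r g
    using m by (intro sum.cong) auto
  show ?thesis
    using assms m unfolding web_annulus_def Let_def length_map s
    by (auto intro!: directed_cycle_face_flip) (auto simp: flip_def)
qed

lemma inward_arrows_flip: "inward_arrows (map flip S) a b = outward_arrows S a b"
  and outward_arrows_flip: "outward_arrows (map flip S) a b = inward_arrows S a b"
  by (induction S) (auto simp: inward_arrows_def outward_arrows_def flip_def)

section \<open>Bracket variables and corners\<close>

text \<open>The labels make one full turn in total, and the step into \<open>f\<close> already uses
  a positive part of it. Starting from label 1 at \<open>f\<close>, later steps therefore never pass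
  from \<open>p\<close> to 1.\<close>

lemma cyclic_labels_mono:
  assumes w: "cyclic_labels p n w" and f: "f \<in> {1..n}" "w f = 1" "w f \<noteq> w (f - 1)"
    and ij: "f \<le> i" "i \<le> j" "j \<le> n"
  shows "w i \<le> w j"
proof -
  define g where "g i = arc p (w (i - 1)) (w i)" for i
  have win: "w j \<in> {1..p}" if "j \<le> n" for j
    using w that by (auto simp: cyclic_labels_def)
  have gf: "g f \<ge> 1"
    using win[of f] win[of "f - 1"] f arc_eq_0_iff[of "w (f - 1)" p "w f"] by (auto simp: g_def)
  have bound: "(\<Sum>i\<in>{f<..j}. g i) < p" if "j \<le> n" for j
  proof -
    have "g f + (\<Sum>i\<in>{f<..j}. g i) = (\<Sum>i\<in>insert f {f<..j}. g i)" by simp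
    also have "\<dots> \<le> (\<Sum>i=1..n. g i)" using f that by (intro sum_mono2) auto
    also have "\<dots> = p" using w by (simp add: cyclic_labels_def g_def)
    finally show ?thesis using gf by simp
  qed
  have eq: "w j = 1 + (\<Sum>i\<in>{f<..j}. g i)" if "f \<le> j" "j \<le> n" for j
    using that
  proof (induction j rule: dec_induct)
    case base
    then show ?case using f by simp
  next
    case (step j)
    have "{f<..Suc j} = insert (Suc j) {f<..j}" using step by auto
    then have s: "(\<Sum>i\<in>{f<..Suc j}. g i) = g (Suc j) + (\<Sum>i\<in>{f<..j}. g i)" by simp
    have "g (Suc j) = (if w j \<le> w (Suc j) then w (Suc j) - w j else p + w (Suc j) - w j)"
      using win[of j] win[of "Suc j"] step by (simp add: g_def arc_eq)
    then show ?case
      using s step bound[of "Suc j"] win[of "Suc j"] win[of j] by (auto split: if_splits)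
  qed
  have "(\<Sum>i\<in>{f<..i}. g i) \<le> (\<Sum>i\<in>{f<..j}. g i)"
    using ij by (intro sum_mono2) auto
  then show ?thesis using eq[of i] eq[of j] ij by simp
qed

text \<open>A change of \<open>w\<close> at \<open>j\<close> gives an arrow from \<open>w j\<close>
  to \<open>j\<close> and one from \<open>j\<close> to \<open>w (j - 1)\<close>. As the labels do
  not decrease from \<open>f\<close> on, the largest source up to \<open>i\<close> is
  \<open>w i\<close>. Before \<open>f\<close> there is no source, and the starred default
  \<open>w n = w 0\<close> is again \<open>w i\<close>.\<close>

lemma well_labelled_brackets:
  assumes Q: "no_loops_or_2_cycles Q" and w: "cyclic_labels p n w" and p: "p > 0"
    and b: "\<And>a j. j \<in> {1..n} \<Longrightarrow>
      bmat Q (circ a) (Middle j) = of_bool (a = w j) - of_bool (a = w (j - 1))"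
    and lab: "well_labelled n Q circ"
  obtains f where "1 \<le> f" "f < n" "w f \<noteq> w 0" "\<And>j. j < f \<Longrightarrow> w j = w 0"
    "\<And>(x :: web_vertex \<Rightarrow> 'f::field) j. j \<in> {1..n} \<Longrightarrow> x_br_star n Q x circ j = x (circ (w j))"
    "\<And>(x :: web_vertex \<Rightarrow> 'f). x_br Q x circ n = x (circ (w n))"
proof -
  have pos: "arrows Q (circ a) (Middle j) > 0 \<longleftrightarrow> a = w j \<and> w j \<noteq> w (j - 1)"
    if "j \<in> {1..n}" for a j
    using b[OF that, of a] by (auto simp: arrows_eq_bmat[OF Q])
  have pos': "arrows Q (Middle j) (circ a) > 0 \<longleftrightarrow> a = w (j - 1) \<and> w j \<noteq> w (j - 1)"
    if "j \<in> {1..n}" for a j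
    using b[OF that, of a] bmat_antisym[of Q "Middle j" "circ a"]
    by (auto simp: arrows_eq_bmat[OF Q])
  define chg where "chg j \<longleftrightarrow> j \<in> {1..n} \<and> w j \<noteq> w (j - 1)" for j
  define f where "f = (LEAST j. chg j)"
  have adj: "(\<exists>a. adjacent Q (circ a) (Middle j)) \<longleftrightarrow> w j \<noteq> w (j - 1)" if "j \<in> {1..n}" for j
    using pos[OF that] pos'[OF that] by (auto simp: adjacent_def)
  then have f_eq: "(LEAST i. i \<in> {1..n} \<and> (\<exists>a. adjacent Q (circ a) (Middle i))) = f"
    unfolding f_def chg_def by (metis (no_types, lifting))
  have "\<exists>j. chg j"
  proof (rule ccontr)
    assume "\<not> ?thesis"
    then have "(\<Sum>j=1..n. arc p (w (j - 1)) (w j)) = 0" by (auto simp: chg_def)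
    then show False using w p by (simp add: cyclic_labels_def)
  qed
  then have f: "chg f" unfolding f_def by (metis LeastI)
  have least: "\<not> chg j" if "j < f" for j using that not_less_Least unfolding f_def by blast
  have const: "w j = w 0" if "j < f" for j
    using that
  proof (induction j)
    case (Suc j)
    then show ?case using least[of "Suc j"] f by (auto simp: chg_def)
  qed simp
  have f1: "1 \<le> f" "f \<le> n" using f by (auto simp: chg_def)
  have wf: "w f \<noteq> w 0" using f const[of "f - 1"] f1 by (auto simp: chg_def)
  then have "f < n" using w f1 by (cases "f = n") (auto simp: cyclic_labels_def)
  \<comment> \<open>The arrow into \<open>Middle f\<close> starts at \<open>w f\<close>, and
    \<open>well_labelled\<close> gives its source the label 1.\<close>
  have "w f = 1"
    using lab pos[of f 1] f unfolding well_labelled_def f_eq by (auto simp: chg_def)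
  then have mono: "w i \<le> w j" if "f \<le> i" "i \<le> j" "j \<le> n" for i j
    using cyclic_labels_mono[OF w, of f i j] f that by (auto simp: chg_def)
  have src: "sources_to Q circ i = {w j | j. chg j \<and> j \<le> i}" if "i \<le> n" for i
    using pos that unfolding sources_to_def chg_def by fastforce
  have last: "\<exists>j. chg j \<and> j \<le> i \<and> w j = w i" if "f \<le> i" "i \<le> n" for i
    using that
  proof (induction i rule: dec_induct)
    case base
    then show ?case using f by auto
  next
    case (step i)
    show ?case
    proof (cases "chg (Suc i)")
      case False
      then have "w (Suc i) = w i" using step by (simp add: chg_def)
      then show ?thesis using step by (metis Suc_leD le_Suc_eq)
    qed auto
  qed
  have src_f: "sources_to Q circ i \<noteq> {}" "Max (sources_to Q circ i) = w i" if i: "f \<le> i" "i \<le> n" for i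
  proof -
    have ge: "f \<le> j" if "chg j" for j using least[of j] that by force
    have m: "w i \<in> sources_to Q circ i" using last[OF i] src[OF i(2)] by auto
    then show "sources_to Q circ i \<noteq> {}" by auto
    have "\<forall>a\<in>sources_to Q circ i. a \<le> w i" using src[OF i(2)] mono i ge by auto
    moreover from this have "finite (sources_to Q circ i)" using finite_nat_set_iff_bounded_le by blast
    ultimately show "Max (sources_to Q circ i) = w i" using m by (intro Max_eqI) auto
  qed
  have src_e: "sources_to Q circ i = {}" if "i < f" for i
    using src[of i] least that f1 by auto
  \<comment> \<open>Targets \<open>w (j - 1)\<close> count as connected too, but monotonicity and
    \<open>w 0 = w n\<close> bound every label by \<open>w n\<close>.\<close>
  have lc: "largest_connected n Q circ = w n"
  proof -
    let ?A = "{a. \<exists>j\<in>{1..n}. adjacent Q (circ a) (Middle j)}"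
    have A: "?A = {w j | j. chg j} \<union> {w (j - 1) | j. chg j}"
    proof (rule set_eqI)
      fix a
      have "adjacent Q (circ a) (Middle j) \<longleftrightarrow> (a = w j \<or> a = w (j - 1)) \<and> w j \<noteq> w (j - 1)"
        if "j \<in> {1..n}" for j
        unfolding adjacent_def pos[OF that] pos'[OF that] by blast
      then show "a \<in> ?A \<longleftrightarrow> a \<in> {w j | j. chg j} \<union> {w (j - 1) | j. chg j}"
        unfolding chg_def by blast
    qed
    have le: "w j \<le> w n" if "j \<le> n" for j
      using mono[of j n] const[of j] that w by (cases "f \<le> j") (auto simp: cyclic_labels_def)
    have "w n \<in> ?A" using last[of n] f1 unfolding A by auto
    moreover have "\<forall>a\<in>?A. a \<le> w n" unfolding A using le by (auto simp: chg_def)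
    moreover from this have "finite ?A" using finite_nat_set_iff_bounded_le by blast
    ultimately show ?thesis unfolding largest_connected_def by (intro Max_eqI) auto
  qed
  show thesis
  proof (rule that[of f])
    fix x :: "web_vertex \<Rightarrow> 'f"
    show "x_br Q x circ n = x (circ (w n))"
      using src_f[of n] f1 by (simp add: x_br_def)
    fix j assume "j \<in> {1..n}"
    then show "x_br_star n Q x circ j = x (circ (w j))"
      using src_f[of j] src_e[of j] const[of j] lc w
      by (cases "f \<le> j") (auto simp: x_br_star_def cyclic_labels_def)
  qed (fact f1 \<open>f < n\<close> wf const)+
qed

section \<open>Subtraction-free rational functions\<close>

text \<open>Membership certifies that an element is a legitimate denominator.\<close>

locale positive_cone =
  fixes P :: "'f::field set"
  assumes add: "a \<in> P \<Longrightarrow> b \<in> P \<Longrightarrow> a + b \<in> P"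
    and mult: "a \<in> P \<Longrightarrow> b \<in> P \<Longrightarrow> a * b \<in> P"
    and divide: "a \<in> P \<Longrightarrow> b \<in> P \<Longrightarrow> a / b \<in> P"
    and nonzero: "0 \<notin> P"

definition sub_free :: "ratfun set" where
  "sub_free = {Fract a b | a b. (\<forall>m. Poly_Mapping.lookup a m \<ge> 0) \<and> a \<noteq> 0 \<and> (\<forall>m. Poly_Mapping.lookup b m \<ge> 0) \<and> b \<noteq> 0}"

lemma lookup_mult_nonneg:
  fixes f g :: "('a::comm_monoid_add) \<Rightarrow>\<^sub>0 ('b::linordered_idom)"
  assumes "\<And>m. Poly_Mapping.lookup f m \<ge> 0" "\<And>m. Poly_Mapping.lookup g m \<ge> 0"
  shows "Poly_Mapping.lookup (f * g) m \<ge> 0"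
proof -
  have "(\<Sum>q. Poly_Mapping.lookup g q when m = l + q) \<ge> 0" for l
    using assms(2) by (auto simp: Sum_any.expand_set when_def intro!: sum_nonneg)
  then show ?thesis
    unfolding lookup_mult using assms(1) by (auto simp: Sum_any.expand_set intro!: sum_nonneg)
qed

text \<open>Nonnegative coefficients cannot cancel in a sum, and the polynomial ring has no zero
  divisors, so numerators and denominators stay nonzero.\<close>

lemma positive_cone_sub_free: "positive_cone sub_free"
proof
  let ?N = "\<lambda>a::(web_vertex \<Rightarrow>\<^sub>0 nat) \<Rightarrow>\<^sub>0 rat. (\<forall>m. Poly_Mapping.lookup a m \<ge> 0) \<and> a \<noteq> 0"
  have m: "?N (a * b)" if "?N a" "?N b" for a b
    using that lookup_mult_nonneg[of a b] by simp
  have p: "?N (a + b)" if ab: "?N a" "?N b" for a b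
  proof -
    have "a + b \<noteq> 0"
    proof
      assume "a + b = 0"
      then have "Poly_Mapping.lookup a m + Poly_Mapping.lookup b m = 0" for m by (metis lookup_add lookup_zero)
      then have "Poly_Mapping.lookup a m = 0" for m using ab by (metis add_nonneg_eq_0_iff)
      then show False using ab by (metis lookup_zero poly_mapping_eqI)
    qed
    then show ?thesis using ab by (simp add: lookup_add)
  qed
  show "0 \<notin> sub_free"
    by (auto simp: sub_free_def Zero_fract_def eq_fract)
  fix a b assume "a \<in> sub_free" "b \<in> sub_free"
  then obtain s t u v where h: "a = Fract s t" "b = Fract u v" "?N s" "?N t" "?N u" "?N v"
    by (auto simp: sub_free_def)
  show "a + b \<in> sub_free" "a * b \<in> sub_free" "a / b \<in> sub_free"
    using h m p unfolding sub_free_def by (auto intro!: exI)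
qed

lemma X_in_sub_free: "X v \<in> sub_free"
proof -
  have "\<forall>m. Poly_Mapping.lookup (Poly_Mapping.single (Poly_Mapping.single v (1::nat)) (1::rat)) m \<ge> 0"
    by (simp add: lookup_single when_def)
  moreover have "Poly_Mapping.single (Poly_Mapping.single v (1::nat)) (1::rat) \<noteq> 0"
    by (metis lookup_single_eq lookup_zero zero_neq_one)
  moreover have "\<forall>m. Poly_Mapping.lookup (1 :: (web_vertex \<Rightarrow>\<^sub>0 nat) \<Rightarrow>\<^sub>0 rat) m \<ge> 0"
    by (simp add: lookup_one when_def)
  ultimately show ?thesis unfolding sub_free_def X_def using one_neq_zero by blast
qed

section \<open>Mutations along the middle circle\<close>

lemma prod_power_of_bool:
  assumes "finite A" "c \<in> A"
  shows "(\<Prod>a\<in>A. g a ^ of_bool (b \<and> a = c)) = (if b then g c else (1::'a::comm_monoid_mult))"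
proof (cases b)
  case True
  have "(\<Prod>a\<in>A. g a ^ of_bool (b \<and> a = c)) = (\<Prod>a\<in>A. if a = c then g a else 1)"
    using True by (intro prod.cong) auto
  then show ?thesis using True assms by simp
qed simp

text \<open>\<open>f\<close> is the least middle vertex that is connected to the circle with labels \<open>w\<close>.\<close>

definition first_change :: "nat \<Rightarrow> nat \<Rightarrow> (nat \<Rightarrow> nat) \<Rightarrow> nat \<Rightarrow> bool" where
  "first_change p n w f \<longleftrightarrow> w 0 = w n \<and> (\<forall>j\<le>n. w j \<in> {1..p}) \<and> 1 \<le> f \<and> f < n \<and>
     w f \<noteq> w 0 \<and> (\<forall>j<f. w j = w 0)"

lemma first_changeD:
  assumes "first_change p n w f"
  shows "w n = w 0" "1 \<le> f" "f < n" "w f \<noteq> w 0"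
    and "\<And>j. j < f \<Longrightarrow> w j = w 0" "\<And>j. j \<le> n \<Longrightarrow> w j \<in> {1..p}"
  using assms unfolding first_change_def by metis+

text \<open>The outer and inner circles are frozen: \<open>tau\<close> mutates at middle vertices
  only. This is the part on one of them of the column at \<open>k\<close> just before the first
  mutation there.\<close>

definition col_frozen :: "(nat \<Rightarrow> nat) \<Rightarrow> nat \<Rightarrow> nat \<Rightarrow> nat \<Rightarrow> int" where
  "col_frozen w f k a = of_bool (f \<le> k \<and> a = w k) - of_bool (k = f \<and> a = w 0)"

lemma nat_col_frozen:
  assumes "first_change p n w f"
  shows "nat (col_frozen w f k a) = of_bool (f \<le> k \<and> a = w k)"
    and "nat (- col_frozen w f k a) = of_bool (k = f \<and> a = w 0)"
  using first_changeD(4)[OF assms] by (auto simp: col_frozen_def)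

lemma col_frozen_1:
  assumes "first_change p n w f"
  shows "of_bool (a = w 1) - of_bool (a = w 0) = col_frozen w f 1 a"
  using first_changeD(2,4)[OF assms] first_changeD(5)[OF assms, of 1]
  by (cases "f = 1") (auto simp: col_frozen_def)

text \<open>Mutation at \<open>k\<close> adds the positive part of column \<open>k\<close> to column
  \<open>k + 1\<close>, where it cancels the entry at \<open>w k\<close>. For \<open>k < f\<close>
  nothing is added, and \<open>w k\<close> is still \<open>w 0\<close>.\<close>

lemma col_frozen_Suc:
  assumes "first_change p n w f"
  shows "of_bool (a = w (Suc k)) - of_bool (a = w k) + max 0 (col_frozen w f k a)
    = col_frozen w f (Suc k) a"
  using first_changeD(4)[OF assms] first_changeD(5)[OF assms, of k] first_changeD(5)[OF assms, of "Suc k"]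
  by (cases "f \<le> k"; cases "f = Suc k") (auto simp: col_frozen_def)

lemma max_neg_col_frozen:
  assumes "first_change p n w f"
  shows "max 0 (- col_frozen w f k a) = of_bool (k = f \<and> a = w 0)"
  using first_changeD(4)[OF assms] by (auto simp: col_frozen_def)

section \<open>Columns at the middle vertices during the first mutations\<close>

text \<open>The difference in \<open>mid\<close> also covers \<open>n = 2\<close>, where the two
  circle arrows cancel.\<close>

locale three_circles =
  fixes Q :: "web_vertex quiver" and p n q :: nat and wo wi :: "nat \<Rightarrow> nat" and fo fi :: nat
  assumes n2: "2 \<le> n" and Q: "no_loops_or_2_cycles Q"
    and verts_Q: "verts Q = Outer ` {1..p} \<union> Middle ` {1..n} \<union> Inner ` {1..q}"
    and mid: "\<And>i j. j \<in> {1..n} \<Longrightarrow>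
      bmat Q (Middle i) (Middle j) = int (circle_arrows n i j) - int (circle_arrows n j i)"
    and outer: "\<And>a j. j \<in> {1..n} \<Longrightarrow>
      bmat Q (Outer a) (Middle j) = of_bool (a = wo j) - of_bool (a = wo (j - 1))"
    and inner: "\<And>a j. j \<in> {1..n} \<Longrightarrow>
      bmat Q (Inner a) (Middle j) = of_bool (a = wi j) - of_bool (a = wi (j - 1))"
    and wo: "first_change p n wo fo" and wi: "first_change q n wi fi"
begin

primrec forward :: "nat \<Rightarrow> web_vertex quiver" where
  "forward 0 = Q"
| "forward (Suc k) = mutate_quiver (Middle (Suc k)) (forward k)"

lemma no_loops_forward: "no_loops_or_2_cycles (forward k)"
  by (cases k) (simp_all add: Q no_loops_or_2_cycles_mutate)

lemma verts_forward [simp]: "verts (forward k) = verts Q"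
  by (induction k) simp_all

text \<open>The columns at \<open>Middle k\<close> and at \<open>Middle n\<close> of the signed adjacency matrix after the
  mutations at \<open>1, \<dots>, k - 1\<close> and \<open>1, \<dots>, k\<close>, respectively.\<close>

definition col :: "nat \<Rightarrow> web_vertex \<Rightarrow> int" where
  "col k v = (case v of
      Outer a \<Rightarrow> col_frozen wo fo k a
    | Middle j \<Rightarrow> of_bool (j = n) - of_bool (1 \<le> j \<and> Suc j = k) - of_bool (j = Suc k)
    | Inner a \<Rightarrow> col_frozen wi fi k a)"

text \<open>Column \<open>n\<close> starts as \<open>w n\<close> minus \<open>w (n - 1)\<close>,
  where \<open>w n = w 0\<close>; the mutation at \<open>f\<close> removes the entry at
  \<open>w 0\<close>.\<close>

definition last_frozen :: "(nat \<Rightarrow> nat) \<Rightarrow> nat \<Rightarrow> nat \<Rightarrow> nat \<Rightarrow> int" where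
  "last_frozen w f k a = of_bool (a = w 0) - of_bool (a = w (n - 1)) - of_bool (f \<le> k \<and> a = w 0)"

definition last_col :: "nat \<Rightarrow> web_vertex \<Rightarrow> int" where
  "last_col k v = (case v of
      Outer a \<Rightarrow> last_frozen wo fo k a
    | Middle j \<Rightarrow> of_bool (Suc j = n) + of_bool (1 \<le> j \<and> j = k) - of_bool (j = Suc k)
    | Inner a \<Rightarrow> last_frozen wi fi k a)"

lemma last_frozen_Suc:
  assumes "first_change r n w f"
  shows "last_frozen w f k a - max 0 (- col_frozen w f (Suc k) a) = last_frozen w f (Suc k) a"
  unfolding max_neg_col_frozen[OF assms] by (auto simp: last_frozen_def)

text \<open>Supplies the opposite columns for \<open>swap_mutate_opposite_twins\<close>. As
  \<open>f\<close> is at most \<open>n - 1\<close>, an entry at \<open>w 0\<close> survives in both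
  columns precisely when \<open>f = n - 1\<close>.\<close>

lemma last_col_eq: "last_col (n - 2) v = - col (n - 1) v"
proof -
  have "last_frozen w f (n - 2) a = - col_frozen w f (n - 1) a" if "first_change r n w f" for w f r a
    using first_changeD(2-4)[OF that] by (auto simp: last_frozen_def col_frozen_def)
  from this[OF wo] this[OF wi] show ?thesis
    using n2 by (auto simp: last_col_def col_def split: web_vertex.split)
qed

text \<open>The mutated column has entry -1 at the next vertex, 1 at \<open>n\<close> and 0 in
  between. So the mutation adds its positive part to the next column, subtracts its negative part
  from column \<open>n\<close> and leaves the columns in between alone; the last fact feeds the next
  induction step.\<close>

lemma forward_cols:
  assumes "k \<le> n - 2"
  shows "bmat (forward k) v (Middle (Suc k)) = col (Suc k) v
    \<and> bmat (forward k) v (Middle n) = last_col k v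
    \<and> (\<forall>j. Suc k < j \<and> j < n \<longrightarrow> bmat (forward k) v (Middle j) = bmat Q v (Middle j))"
  using assms
proof (induction k arbitrary: v)
  case 0
  have "bmat Q v (Middle 1) = col 1 v"
  proof (cases v)
    case (Outer a)
    then show ?thesis using outer[of 1 a] n2 col_frozen_1[OF wo, of a] by (simp add: col_def)
  next
    case (Middle j)
    then show ?thesis using mid[of 1 j] n2 by (auto simp: col_def circle_arrows_def)
  next
    case (Inner a)
    then show ?thesis using inner[of 1 a] n2 col_frozen_1[OF wi, of a] by (simp add: col_def)
  qed
  moreover have "bmat Q v (Middle n) = last_col 0 v"
  proof (cases v)
    case (Outer a)
    then show ?thesis using outer[of n a] n2 first_changeD(1,2)[OF wo]
      by (simp add: last_col_def last_frozen_def)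
  next
    case (Middle j)
    then show ?thesis using mid[of n j] n2 by (auto simp: last_col_def circle_arrows_def)
  next
    case (Inner a)
    then show ?thesis using inner[of n a] n2 first_changeD(1,2)[OF wi]
      by (simp add: last_col_def last_frozen_def)
  qed
  ultimately show ?case by simp
next
  case (Suc k)
  let ?m = "Suc k"
  have m: "Suc ?m < n" using Suc.prems by simp
  have IH: "bmat (forward k) v (Middle ?m) = col ?m v" "bmat (forward k) v (Middle n) = last_col k v"
    "\<And>j. ?m < j \<Longrightarrow> j < n \<Longrightarrow> bmat (forward k) v (Middle j) = bmat Q v (Middle j)" for v
    using Suc by simp_all
  have row: "bmat (forward k) (Middle ?m) v = - col ?m v" for v
    using IH(1) bmat_antisym by metis
  have step: "bmat (forward ?m) v (Middle j) =
      (if v = Middle ?m then col ?m (Middle j)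
       else bmat (forward k) v (Middle j) + (max 0 (col ?m v) * max 0 (- col ?m (Middle j))
         - max 0 (col ?m (Middle j)) * max 0 (- col ?m v)))" if "j \<noteq> ?m" for j
    using that by (simp add: bmat_mutate_quiver[OF no_loops_forward] IH(1) row)
  have c: "col ?m (Middle (Suc ?m)) = - 1" "col ?m (Middle n) = 1"
    "\<And>j. Suc ?m < j \<Longrightarrow> j < n \<Longrightarrow> col ?m (Middle j) = 0"
    using m by (auto simp: col_def)
  have A: "bmat (forward ?m) v (Middle (Suc ?m)) = col (Suc ?m) v"
  proof (cases v)
    case (Outer a)
    then show ?thesis
      using step[of "Suc ?m"] c(1) IH(3)[of "Suc ?m" v] outer[of "Suc ?m" a] m
        col_frozen_Suc[OF wo, of a ?m] by (simp add: col_def)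
  next
    case (Middle j)
    then show ?thesis
      using step[of "Suc ?m"] c(1) IH(3)[of "Suc ?m" v] mid[of "Suc ?m" j] m
      by (auto simp: col_def circle_arrows_def)
  next
    case (Inner a)
    then show ?thesis
      using step[of "Suc ?m"] c(1) IH(3)[of "Suc ?m" v] inner[of "Suc ?m" a] m
        col_frozen_Suc[OF wi, of a ?m] by (simp add: col_def)
  qed
  have B: "bmat (forward ?m) v (Middle n) = last_col ?m v"
  proof (cases v)
    case (Outer a)
    then show ?thesis
      using step[of n] c(2) IH(2) m last_frozen_Suc[OF wo, of k a]
      by (simp add: col_def last_col_def)
  next
    case (Middle j)
    then show ?thesis
      using step[of n] c(2) IH(2) m by (auto simp: col_def last_col_def)
  next
    case (Inner a)
    then show ?thesis
      using step[of n] c(2) IH(2) m last_frozen_Suc[OF wi, of k a]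
      by (simp add: col_def last_col_def)
  qed
  have "bmat (forward ?m) v (Middle j) = bmat Q v (Middle j)" if j: "Suc ?m < j" "j < n" for j
  proof (cases "v = Middle ?m")
    case True
    then show ?thesis
      using step[of j] c(3)[OF j] mid[of j ?m] j by (auto simp: circle_arrows_def)
  next
    case False
    then show ?thesis using step[of j] c(3)[OF j] IH(3)[of j v] j by simp
  qed
  then show ?case using A B by blast
qed

section \<open>The monomials of the exchange relations\<close>

lemma prod_verts:
  "(\<Prod>v\<in>verts Q. g v) = (\<Prod>a\<in>{1..p}. g (Outer a)) * (\<Prod>j\<in>{1..n}. g (Middle j)) *
     (\<Prod>a\<in>{1..q}. g (Inner a))" for g :: "web_vertex \<Rightarrow> 'f::comm_monoid_mult"
proof -
  have i: "inj_on Outer A" "inj_on Middle A" "inj_on Inner A" for A by (auto simp: inj_on_def)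
  show ?thesis
    unfolding verts_Q by (subst prod.union_disjoint; (subst prod.union_disjoint)?)
      (auto simp: prod.reindex i)
qed

definition frozen_in :: "(web_vertex \<Rightarrow> 'f::field) \<Rightarrow> nat \<Rightarrow> 'f" where
  "frozen_in y k = (if fo \<le> k then y (Outer (wo k)) else 1) * (if fi \<le> k then y (Inner (wi k)) else 1)"

definition frozen_out :: "(web_vertex \<Rightarrow> 'f::field) \<Rightarrow> nat \<Rightarrow> 'f" where
  "frozen_out y k = (if k = fo then y (Outer (wo 0)) else 1) * (if k = fi then y (Inner (wi 0)) else 1)"

lemma prod_frozen:
  assumes w: "first_change r n w f" and k: "k \<le> n"
  shows "(\<Prod>a\<in>{1..r}. g a ^ nat (col_frozen w f k a)) = (if f \<le> k then g (w k) else (1::'f::field))"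
    and "(\<Prod>a\<in>{1..r}. g a ^ nat (- col_frozen w f k a)) = (if k = f then g (w 0) else (1::'f::field))"
proof -
  have "w k \<in> {1..r}" "w 0 \<in> {1..r}" using first_changeD(6)[OF w] k by blast+
  then show "(\<Prod>a\<in>{1..r}. g a ^ nat (col_frozen w f k a)) = (if f \<le> k then g (w k) else 1)"
    "(\<Prod>a\<in>{1..r}. g a ^ nat (- col_frozen w f k a)) = (if k = f then g (w 0) else 1)"
    unfolding nat_col_frozen[OF w] by (subst prod_power_of_bool; simp)+
qed

text \<open>For \<open>k = n - 1\<close> the entries of \<open>col k\<close> at \<open>n\<close> and
  at \<open>k + 1\<close> cancel, so the variable at \<open>Middle n\<close> drops out.\<close>

lemma prod_in:
  assumes "1 \<le> k" "k < n"
  shows "(\<Prod>v\<in>verts Q. y v ^ nat (col k v)) =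
    (if Suc k < n then y (Middle n) else 1) * frozen_in y k"
proof -
  have "(\<Prod>j\<in>{1..n}. y (Middle j) ^ nat (col k (Middle j)))
      = (\<Prod>j\<in>{1..n}. y (Middle j) ^ of_bool (Suc k < n \<and> j = n))"
    using assms by (intro prod.cong) (auto simp: col_def)
  also have "\<dots> = (if Suc k < n then y (Middle n) else 1)"
    using n2 by (subst prod_power_of_bool) auto
  finally show ?thesis
    using assms prod_frozen(1)[OF wo, of k "\<lambda>a. y (Outer a)"] prod_frozen(1)[OF wi, of k "\<lambda>a. y (Inner a)"]
    by (simp add: prod_verts frozen_in_def col_def)
qed

lemma prod_out:
  assumes "1 \<le> k" "k < n"
  shows "(\<Prod>v\<in>verts Q. y v ^ nat (- col k v)) =
    (if k = 1 then 1 else y (Middle (k - 1))) * (if Suc k < n then y (Middle (Suc k)) else 1) *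
    frozen_out y k"
proof -
  have "(\<Prod>j\<in>{1..n}. y (Middle j) ^ nat (- col k (Middle j)))
      = (\<Prod>j\<in>{1..n}. y (Middle j) ^ of_bool (k \<noteq> 1 \<and> j = k - 1) *
          y (Middle j) ^ of_bool (Suc k < n \<and> j = Suc k))"
    using assms by (intro prod.cong) (auto simp: col_def)
  also have "\<dots> = (\<Prod>j\<in>{1..n}. y (Middle j) ^ of_bool (k \<noteq> 1 \<and> j = k - 1)) *
      (\<Prod>j\<in>{1..n}. y (Middle j) ^ of_bool (Suc k < n \<and> j = Suc k))"
    by (rule prod.distrib)
  also have "(\<Prod>j\<in>{1..n}. y (Middle j) ^ of_bool (k \<noteq> 1 \<and> j = k - 1))
      = (if k = 1 then 1 else y (Middle (k - 1)))"
  proof (cases "k = 1")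
    case False
    then have "k - 1 \<in> {1..n}" using assms by auto
    then show ?thesis using False by (subst prod_power_of_bool) auto
  qed simp
  also have "(\<Prod>j\<in>{1..n}. y (Middle j) ^ of_bool (Suc k < n \<and> j = Suc k))
      = (if Suc k < n then y (Middle (Suc k)) else 1)"
    using assms prod_power_of_bool[of "{1..n}" "Suc k" "\<lambda>j. y (Middle j)" "Suc k < n"]
    by (cases "Suc k < n") auto
  finally show ?thesis
    using assms prod_frozen(2)[OF wo, of k "\<lambda>a. y (Outer a)"] prod_frozen(2)[OF wi, of k "\<lambda>a. y (Inner a)"]
    by (simp add: prod_verts frozen_out_def col_def)
qed

lemma mutate_eq:
  assumes R: "no_loops_or_2_cycles R" "verts R = verts Q" and c: "\<And>v. bmat R v k = c v"
  shows "mutate k \<lparr>quiver = R, cvar = y\<rparr> = \<lparr>quiver = mutate_quiver k R,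
    cvar = y(k := ((\<Prod>v\<in>verts Q. y v ^ nat (- c v)) + (\<Prod>v\<in>verts Q. y v ^ nat (c v))) / y k)\<rparr>"
proof -
  have "bmat R k v = - c v" for v using bmat_antisym[of R k v] c by simp
  then show ?thesis using R c by (simp add: mutate_def arrows_eq_bmat)
qed

end

section \<open>Cluster variables on the way forth and back\<close>

locale three_circles_seed = three_circles + positive_cone P
  for P :: "'f::field set" +
  fixes x :: "web_vertex \<Rightarrow> 'f"
  assumes x: "x v \<in> P"
begin

lemma x_nz [simp]: "x v \<noteq> 0"
  using x nonzero by metis

abbreviation xm where "xm j \<equiv> x (Middle j)"

definition W where "W j = x (Outer (wo j)) * x (Inner (wi j))"

text \<open>Clears the frozen variables that the exchange relations at vertices up to \<open>k\<close> have not
  introduced yet; after that the relations take the same form at every vertex.\<close>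

definition E where
  "E k = (if k < fo then x (Outer (wo 0)) else 1) * (if k < fi then x (Inner (wi 0)) else 1)"

text \<open>Closed form of the recursion \<open>H_Suc\<close>, the exchange relation with its frozen
  factors cleared. The quotient \<open>u k\<close> is the variable at \<open>k\<close> after the
  first mutation there, for \<open>k\<close> from 1 to \<open>n - 2\<close>.\<close>

definition H where
  "H k = xm (Suc k) * (xm n * (\<Sum>j=1..k. W j / (xm j * xm (Suc j))) + W 0 / xm 1)"

definition u where "u k = H k / E k"

text \<open>This is \<open>xbar\<close> with each summand of the numerator divided by the product of
  all middle variables; see \<open>xbar_eq_Y\<close>.\<close>

definition Y where
  "Y = (\<Sum>j=1..n-1. W j / (xm j * xm (Suc j))) + W 0 / (xm 1 * xm n)"

lemma W_in: "W j \<in> P"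
  by (simp add: W_def mult x)

text \<open>The sum in \<open>H\<close> may be empty and 0 is not in \<open>P\<close>, so membership
  is derived from the recursion.\<close>

lemma H_in: "H k \<in> P"
proof (induction k)
  case 0
  then show ?case by (simp add: H_def W_in x mult divide)
next
  case (Suc k)
  have "H (Suc k) = xm (Suc (Suc k)) * (xm n * (W (Suc k) / (xm (Suc k) * xm (Suc (Suc k)))) + H k / xm (Suc k))"
    by (simp add: H_def field_simps)
  then show ?case using Suc by (simp add: W_in x mult divide add)
qed

lemma H_nz [simp]: "H k \<noteq> 0"
  using H_in nonzero by metis

lemma E_nz [simp]: "E k \<noteq> 0"
  by (simp add: E_def)

lemma u_nz [simp]: "u k \<noteq> 0"
  by (simp add: u_def)

lemma f_pos: "1 \<le> fo" "1 \<le> fi" "fo < n" "fi < n"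
  using first_changeD(2,3)[OF wo] first_changeD(2,3)[OF wi] by auto

text \<open>Lets \<open>u 0\<close> stand for the missing predecessor of vertex 1, which gives the
  exchange relation at 1 the general form.\<close>

lemma u_0: "u 0 = 1"
  using f_pos by (simp add: u_def H_def E_def W_def)

text \<open>Below \<open>f\<close> the variable missing from \<open>frozen_in\<close> is supplied by
  \<open>E\<close>, because \<open>w k = w 0\<close> there.\<close>

lemma frozen_in_E: "frozen_in x k * E k = W k"
proof -
  have "k < fo \<Longrightarrow> wo k = wo 0" "k < fi \<Longrightarrow> wi k = wi 0"
    by (rule first_changeD(5)[OF wo], assumption) (rule first_changeD(5)[OF wi])
  then show ?thesis unfolding frozen_in_def E_def W_def
    by (cases "k < fo"; cases "k < fi") simp_all
qed

text \<open>The variable at \<open>w 0\<close> leaves \<open>E\<close> at the index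
  \<open>f\<close>, exactly where it enters \<open>frozen_out\<close>.\<close>

lemma frozen_out_E: "frozen_out x (Suc k) * E (Suc k) = E k"
proof -
  have "k < fo \<longleftrightarrow> Suc k < fo \<or> Suc k = fo" "k < fi \<longleftrightarrow> Suc k < fi \<or> Suc k = fi" by auto
  then show ?thesis unfolding frozen_out_def E_def by auto
qed

lemma H_Suc: "xm (Suc k) * H (Suc k) = xm n * W (Suc k) + xm (Suc (Suc k)) * H k"
  by (simp add: H_def field_simps)

lemma exchange:
  "xm (Suc k) * u (Suc k) = u k * xm (Suc (Suc k)) * frozen_out x (Suc k) + xm n * frozen_in x (Suc k)"
proof -
  have "xm (Suc k) * u (Suc k) * E (Suc k) = xm n * W (Suc k) + xm (Suc (Suc k)) * (u k * E k)"
    using H_Suc[of k] by (simp add: u_def)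
  also have "\<dots> = (u k * xm (Suc (Suc k)) * frozen_out x (Suc k) + xm n * frozen_in x (Suc k)) * E (Suc k)"
    unfolding frozen_in_E[symmetric] frozen_out_E[symmetric, of k] by (simp add: algebra_simps)
  finally show ?thesis by simp
qed

text \<open>Both \<open>fo\<close> and \<open>fi\<close> are below \<open>n\<close>, so
  \<open>E (n - 1) = 1\<close> and the left side is \<open>H (n - 2) + W (n - 1)\<close>, which
  collects all terms of \<open>Y\<close>.\<close>

lemma exchange_last:
  "u (n - 2) * frozen_out x (n - 1) + frozen_in x (n - 1) = xm (n - 1) * xm n * Y"
proof -
  define N where "N = n - 2"
  have N: "n = Suc (Suc N)" using n2 by (simp add: N_def)
  then have N': "n - 1 = Suc N" by simp
  have "\<not> n - 1 < fo" "\<not> n - 1 < fi" using f_pos by auto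
  then have E1: "E (n - 1) = 1" by (simp add: E_def)
  have "u N * frozen_out x (Suc N) + frozen_in x (Suc N) = u N * E N + W (Suc N)"
    using frozen_in_E[of "Suc N"] frozen_out_E[of N] E1 unfolding N' by simp
  also have "\<dots> = H N + W (Suc N)" by (simp add: u_def)
  also have "\<dots> = xm (Suc N) * xm n * Y"
    unfolding H_def Y_def N' by (simp add: N[symmetric] field_simps)
  finally show ?thesis by (simp only: N' N_def)
qed

text \<open>The variables \<open>1, \<dots>, k\<close> are mutated and the remaining middle variables are scaled by \<open>t\<close>.
  The seeds on the way back differ from those on the way forth by \<open>t = Y\<close> instead of \<open>t = 1\<close>.\<close>

definition clus :: "nat \<Rightarrow> 'f \<Rightarrow> web_vertex \<Rightarrow> 'f" where
  "clus k t v = (case v of Middle j \<Rightarrow>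
      if j \<in> {1..k} then u j else if j \<in> {1..n} then t * x v else x v | _ \<Rightarrow> x v)"

lemma clus_frozen [simp]:
  "clus k t (Outer a) = x (Outer a)" "clus k t (Inner a) = x (Inner a)"
  by (simp_all add: clus_def)

lemma frozen_clus [simp]:
  "frozen_in (clus k t) j = frozen_in x j" "frozen_out (clus k t) j = frozen_out x j"
  by (simp_all only: frozen_in_def frozen_out_def clus_frozen)

text \<open>The case \<open>l = k\<close> serves the way forth and \<open>l = Suc k\<close> the way
  back, as the variable at \<open>Suc k\<close> does not occur. Exactly one scaled variable does,
  hence the factor \<open>t\<close>.\<close>

lemma clus_in:
  assumes "Suc (Suc k) < n" "l \<le> Suc k" "k \<le> l"
  shows "(\<Prod>v\<in>verts Q. clus l t v ^ nat (col (Suc k) v)) = t * (xm n * frozen_in x (Suc k))"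
  using assms by (simp add: prod_in) (simp add: clus_def)

lemma clus_out:
  assumes "Suc (Suc k) < n" "l \<le> Suc k" "k \<le> l"
  shows "(\<Prod>v\<in>verts Q. clus l t v ^ nat (- col (Suc k) v)) =
    t * (u k * xm (Suc (Suc k)) * frozen_out x (Suc k))"
  using assms by (cases k) (simp_all add: prod_out, simp_all add: clus_def u_0)

lemma mutate_forth:
  assumes k: "Suc (Suc k) < n"
  shows "mutate (Middle (Suc k)) \<lparr>quiver = forward k, cvar = clus k 1\<rparr>
    = \<lparr>quiver = forward (Suc k), cvar = clus (Suc k) 1\<rparr>"
proof -
  have c: "bmat (forward k) v (Middle (Suc k)) = col (Suc k) v" for v
    using forward_cols[of k v] k by simp
  have "clus k 1 (Middle (Suc k)) = xm (Suc k)" by (simp add: clus_def)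
  then have "(clus k 1)(Middle (Suc k) := (1 * (u k * xm (Suc (Suc k)) * frozen_out x (Suc k)) +
      1 * (xm n * frozen_in x (Suc k))) / clus k 1 (Middle (Suc k))) = clus (Suc k) 1"
    using exchange[of k, symmetric] by (auto simp: fun_eq_iff clus_def split: web_vertex.split)
  then show ?thesis
    unfolding mutate_eq[OF no_loops_forward verts_forward c]
      clus_in[OF k le_SucI[OF order.refl] order.refl] clus_out[OF k le_SucI[OF order.refl] order.refl]
    by simp
qed

text \<open>The column has been negated, so the two monomials trade places. Both carry
  \<open>t\<close>, and \<open>exchange\<close> turns their sum into
  \<open>t * xm (Suc k) * u (Suc k)\<close>.\<close>

lemma mutate_back:
  assumes k: "Suc (Suc k) < n"
  shows "mutate (Middle (Suc k)) \<lparr>quiver = forward (Suc k), cvar = clus (Suc k) t\<rparr>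
    = \<lparr>quiver = forward k, cvar = clus k t\<rparr>"
proof -
  have "bmat (forward k) v (Middle (Suc k)) = col (Suc k) v" for v
    using forward_cols[of k v] k by simp
  then have c: "bmat (forward (Suc k)) v (Middle (Suc k)) = - col (Suc k) v" for v
    by (simp add: bmat_mutate_quiver[OF no_loops_forward])
  have "clus (Suc k) t (Middle (Suc k)) = u (Suc k)" by (simp add: clus_def)
  moreover have "t * (xm n * frozen_in x (Suc k)) + t * (u k * xm (Suc (Suc k)) * frozen_out x (Suc k))
      = t * xm (Suc k) * u (Suc k)"
    using exchange[of k] by (simp add: algebra_simps)
  ultimately have "(clus (Suc k) t)(Middle (Suc k) := (t * (xm n * frozen_in x (Suc k)) +
      t * (u k * xm (Suc (Suc k)) * frozen_out x (Suc k))) / clus (Suc k) t (Middle (Suc k))) = clus k t"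
    using k by (auto simp: fun_eq_iff clus_def split: web_vertex.split)
  moreover have "mutate_quiver (Middle (Suc k)) (forward (Suc k)) = forward k"
    by (simp add: mutate_quiver_involution[OF no_loops_forward])
  ultimately show ?thesis
    unfolding mutate_eq[OF no_loops_forward verts_forward c] minus_minus
      clus_in[OF k order.refl le_SucI[OF order.refl]] clus_out[OF k order.refl le_SucI[OF order.refl]]
    by simp
qed

lemma fold_forth:
  "k \<le> n - 2 \<Longrightarrow> fold mutate (map Middle [1..<Suc k]) \<lparr>quiver = Q, cvar = x\<rparr>
    = \<lparr>quiver = forward k, cvar = clus k 1\<rparr>"
proof (induction k)
  case 0
  have "clus 0 1 = x" by (auto simp: fun_eq_iff clus_def split: web_vertex.split)
  then show ?case by simp
next
  case (Suc k)
  then show ?case using mutate_forth[of k] by simp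
qed

lemma fold_back:
  "k \<le> n - 2 \<Longrightarrow> fold mutate (map Middle (rev [1..<Suc k])) \<lparr>quiver = forward k, cvar = clus k t\<rparr>
    = \<lparr>quiver = Q, cvar = clus 0 t\<rparr>"
proof (induction k)
  case (Suc k)
  then show ?case using mutate_back[of k] by simp
qed simp

text \<open>Both exchange relations have the right side \<open>xm (n - 1) * xm n * Y\<close>.
  Division by the old variables gives \<open>xm n * Y\<close> at \<open>n - 1\<close> and
  \<open>xm (n - 1) * Y\<close> at \<open>n\<close>, and the swap puts these in order.\<close>

lemma turn:
  "swap_vertices (Middle (n - 1)) (Middle n) (mutate (Middle n) (mutate (Middle (n - 1))
     \<lparr>quiver = forward (n - 2), cvar = clus (n - 2) 1\<rparr>))
   = \<lparr>quiver = forward (n - 2), cvar = clus (n - 2) Y\<rparr>"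
proof -
  let ?a = "Middle (n - 1)" and ?b = "Middle n" and ?F = "forward (n - 2)" and ?y = "clus (n - 2) 1"
  let ?G = "mutate_quiver ?a ?F"
  have S: "Suc (n - 2) = n - 1" using n2 by simp
  have ca: "bmat ?F v ?a = col (n - 1) v" for v
    using forward_cols[of "n - 2" v] S by simp
  have cb: "bmat ?F v ?b = - col (n - 1) v" for v
    using forward_cols[of "n - 2" v] last_col_eq by simp
  have ab: "?a \<noteq> ?b" "?a \<in> verts ?F" "?b \<in> verts ?F" using n2 by (auto simp: verts_Q)
  have z: "col (n - 1) ?a = 0" "col (n - 1) ?b = 0"
    using ca[of ?a] cb[of ?b] by auto
  have cG: "bmat ?G v ?b = - col (n - 1) v" for v
    using ab(1) cb z ca bmat_antisym[of ?F ?a ?b] by (simp add: bmat_mutate_quiver[OF no_loops_forward])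
  have quiv: "swap_quiver ?a ?b (mutate_quiver ?b ?G) = ?F"
    by (intro swap_mutate_opposite_twins no_loops_forward ab) (simp only: ca cb)
  have vals: "?y ?a = xm (n - 1)" "?y ?b = xm n"
    using n2 by (auto simp: clus_def)
  have k: "1 \<le> n - 1" "n - 1 < n" "\<not> Suc (n - 1) < n" using n2 by auto
  \<comment> \<open>The value \<open>r\<close> at \<open>n - 1\<close> is arbitrary because the
    column vanishes there; so one identity serves both mutations.\<close>
  have prods: "(\<Prod>v\<in>verts Q. y v ^ nat (- col (n - 1) v)) + (\<Prod>v\<in>verts Q. y v ^ nat (col (n - 1) v))
      = xm (n - 1) * xm n * Y"
    if "y = ?y(?a := r)" for y r
  proof -
    have "y (Outer a) = x (Outer a)" "y (Inner a) = x (Inner a)" for a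
      by (simp_all add: that)
    then have f: "frozen_in y (n - 1) = frozen_in x (n - 1)" "frozen_out y (n - 1) = frozen_out x (n - 1)"
      by (simp_all only: frozen_in_def frozen_out_def)
    have "(if n - 1 = 1 then 1 else y (Middle (n - 1 - 1))) = u (n - 2)"
    proof (cases "n = 2")
      case True
      then have "n - 1 = 1" "n - 2 = 0" by auto
      then show ?thesis by (simp only: u_0 simp_thms if_True)
    next
      case False
      then have "n - 1 - 1 = n - 2" "n - 2 \<in> {1..n - 2}" "n - 2 \<noteq> n - 1" using n2 by auto
      moreover have "n - 1 \<noteq> 1" using False n2 by auto
      ultimately show ?thesis by (simp add: that clus_def)
    qed
    then show ?thesis
      using exchange_last k by (simp only: prod_in[OF k(1,2)] prod_out[OF k(1,2)] f if_False) simp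
  qed
  have first: "mutate ?a \<lparr>quiver = ?F, cvar = ?y\<rparr> = \<lparr>quiver = ?G, cvar = ?y(?a := xm n * Y)\<rparr>"
    unfolding mutate_eq[OF no_loops_forward verts_forward ca] prods[OF fun_upd_triv[symmetric]] vals
    by simp
  have second: "mutate ?b \<lparr>quiver = ?G, cvar = ?y(?a := xm n * Y)\<rparr>
      = \<lparr>quiver = mutate_quiver ?b ?G, cvar = ?y(?a := xm n * Y, ?b := xm (n - 1) * Y)\<rparr>"
    using prods[OF refl, of "xm n * Y"] ab(1) vals
    by (subst mutate_eq[OF no_loops_or_2_cycles_mutate _ cG]) (simp_all add: add.commute)
  have "(\<lambda>v. (?y(?a := xm n * Y, ?b := xm (n - 1) * Y)) (transpose ?a ?b v)) = clus (n - 2) Y"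
  proof
    fix v
    consider "v = ?a" | "v = ?b" | "v \<noteq> ?a" "v \<noteq> ?b" by blast
    then show "(?y(?a := xm n * Y, ?b := xm (n - 1) * Y)) (transpose ?a ?b v) = clus (n - 2) Y v"
    proof cases
      case 3
      then show ?thesis by (auto simp: clus_def split: web_vertex.split)
    qed (use n2 in \<open>auto simp: clus_def\<close>)
  qed
  then show ?thesis
    unfolding first second using quiv by (simp add: swap_vertices_def swap_quiver_def)
qed

lemma tau_middle:
  assumes "i \<in> {1..n}"
  shows "cvar (tau n \<lparr>quiver = Q, cvar = x\<rparr>) (Middle i) = xm i * Y"
proof -
  define N where "N = n - 2"
  have N: "n = Suc (Suc N)" using n2 by (simp add: N_def)
  have "[1..<n + 1] = [1..<Suc N] @ [n - 1, n]" by (simp add: N)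
  then have "tau n \<lparr>quiver = Q, cvar = x\<rparr> = \<lparr>quiver = Q, cvar = clus 0 Y\<rparr>"
    using fold_forth[of N] turn fold_back[of N] by (simp add: tau_def N)
  then show ?thesis using assms by (simp add: clus_def)
qed

text \<open>Each numerator term lacks just two neighbouring factors of the full product: those at
  \<open>j\<close> and \<open>j + 1\<close>, or those at \<open>n\<close> and 1.\<close>

lemma xbar_eq_Y:
  assumes "\<And>j. j \<in> {1..n} \<Longrightarrow> x_br_star n Q x Outer j = x (Outer (wo j))"
    "\<And>j. j \<in> {1..n} \<Longrightarrow> x_br_star n Q x Inner j = x (Inner (wi j))"
    "x_br Q x Outer n = x (Outer (wo n))" "x_br Q x Inner n = x (Inner (wi n))"
  shows "xbar n Q x = Y"
proof -
  let ?P = "\<Prod>k=1..n. xm k"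
  have P0: "?P \<noteq> 0" by simp
  have split: "?P = (\<Prod>k=1..j-1. xm k) * (\<Prod>k=j+2..n. xm k) * (xm j * xm (Suc j))"
    if "j \<in> {1..n-1}" for j
  proof -
    have "{1..n} = ({1..j-1} \<union> {j+2..n}) \<union> {j, Suc j}" using that by auto
    moreover have "(\<Prod>k\<in>({1..j-1} \<union> {j+2..n}) \<union> {j, Suc j}. xm k) =
        (\<Prod>k\<in>{1..j-1} \<union> {j+2..n}. xm k) * (\<Prod>k\<in>{j, Suc j}. xm k)"
      using that by (intro prod.union_disjoint) auto
    moreover have "(\<Prod>k\<in>{1..j-1} \<union> {j+2..n}. xm k) = (\<Prod>k=1..j-1. xm k) * (\<Prod>k=j+2..n. xm k)"
      using that by (intro prod.union_disjoint) auto
    ultimately show ?thesis by simp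
  qed
  have ends: "?P = (\<Prod>k=2..n-1. xm k) * (xm 1 * xm n)"
  proof -
    have "{1..n} = {2..n-1} \<union> {1, n}" using n2 by auto
    moreover have "(\<Prod>k\<in>{2..n-1} \<union> {1, n}. xm k) = (\<Prod>k=2..n-1. xm k) * (\<Prod>k\<in>{1, n}. xm k)"
      using n2 by (intro prod.union_disjoint) auto
    ultimately show ?thesis using n2 by simp
  qed
  have "(\<Prod>k=1..j-1. xm k) * (\<Prod>k=j+2..n. xm k) * x_br_star n Q x Outer j * x_br_star n Q x Inner j
      = ?P * (W j / (xm j * xm (Suc j)))" if "j \<in> {1..n-1}" for j
    using that assms(1,2)[of j] unfolding split[OF that] by (auto simp: W_def)
  \<comment> \<open>The corner of the closing arrow from \<open>n\<close> to 1 also has index 0, so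
    \<open>W 0\<close> appears here.\<close>
  moreover have "(\<Prod>k=2..n-1. xm k) * x_br Q x Outer n * x_br Q x Inner n
      = ?P * (W 0 / (xm 1 * xm n))"
    unfolding ends using first_changeD(1)[OF wo] first_changeD(1)[OF wi] by (simp add: W_def assms(3,4))
  ultimately have "xbar n Q x = ?P * Y / ?P"
    by (simp add: xbar_def Y_def sum_distrib_left distrib_left)
  then show ?thesis using P0 by simp
qed

end

section \<open>From spider webs to three circles\<close>

lemma spider_web_three_circles:
  assumes "spider_web_quiver n Q"
  obtains p q wo wi fo fi where "three_circles Q p n q wo wi fo fi"
    "\<And>(x :: web_vertex \<Rightarrow> 'f::field) j. j \<in> {1..n} \<Longrightarrow> x_br_star n Q x Outer j = x (Outer (wo j))"
    "\<And>(x :: web_vertex \<Rightarrow> 'f) j. j \<in> {1..n} \<Longrightarrow> x_br_star n Q x Inner j = x (Inner (wi j))"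
    "\<And>(x :: web_vertex \<Rightarrow> 'f). x_br Q x Outer n = x (Outer (wo n))"
    "\<And>(x :: web_vertex \<Rightarrow> 'f). x_br Q x Inner n = x (Inner (wi n))"
proof -
  obtain p q S T where pq: "p \<ge> 2" "n \<ge> 2" "q \<ge> 2"
    and S: "web_annulus p n S" and T: "web_annulus n q T" and Q: "Q = web_quiver p n q S T"
    and lab: "well_labelled n Q Outer" "well_labelled n Q Inner"
    using assms by (auto simp: spider_web_quiver_def)
  have n2c: "no_loops_or_2_cycles Q" unfolding Q by (rule no_loops_or_2_cycles_web_quiver)
  have b: "bmat Q u v = int (web_arrows p n q S T u v) - int (web_arrows p n q S T v u)" for u v
    unfolding Q by (simp add: bmat_def web_quiver_def remove_2_cycles_def of_nat_diff split: nat_diff_split)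
  obtain wo where wo: "cyclic_labels p n wo"
    and bo: "\<And>a j. j \<in> {1..n} \<Longrightarrow> int (inward_arrows S a j) - int (outward_arrows S j a)
       = of_bool (a = wo j) - of_bool (a = wo (j - 1))"
    using web_annulus_labels[OF S] pq by auto
  \<comment> \<open>The inner annulus is turned inside out, which exchanges inward and outward
    arrows.\<close>
  obtain wi where wi: "cyclic_labels q n wi"
    and bi: "\<And>a j. j \<in> {1..n} \<Longrightarrow> int (outward_arrows T a j) - int (inward_arrows T j a)
       = of_bool (a = wi j) - of_bool (a = wi (j - 1))"
    using web_annulus_labels[OF web_annulus_flip[OF T]] pq
    unfolding inward_arrows_flip outward_arrows_flip by auto
  have co: "bmat Q (Outer a) (Middle j) = of_bool (a = wo j) - of_bool (a = wo (j - 1))"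
    and ci: "bmat Q (Inner a) (Middle j) = of_bool (a = wi j) - of_bool (a = wi (j - 1))"
    if "j \<in> {1..n}" for a j
    using bo[OF that] bi[OF that] by (simp_all add: b)
  have "p > 0" "q > 0" using pq by auto
  obtain fo where fo: "1 \<le> fo" "fo < n" "wo fo \<noteq> wo 0" "\<And>j. j < fo \<Longrightarrow> wo j = wo 0"
    "\<And>(x :: web_vertex \<Rightarrow> 'f) j. j \<in> {1..n} \<Longrightarrow> x_br_star n Q x Outer j = x (Outer (wo j))"
    "\<And>(x :: web_vertex \<Rightarrow> 'f). x_br Q x Outer n = x (Outer (wo n))"
    using well_labelled_brackets[OF n2c wo \<open>p > 0\<close> co lab(1)] by blast
  obtain fi where fi: "1 \<le> fi" "fi < n" "wi fi \<noteq> wi 0" "\<And>j. j < fi \<Longrightarrow> wi j = wi 0"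
    "\<And>(x :: web_vertex \<Rightarrow> 'f) j. j \<in> {1..n} \<Longrightarrow> x_br_star n Q x Inner j = x (Inner (wi j))"
    "\<And>(x :: web_vertex \<Rightarrow> 'f). x_br Q x Inner n = x (Inner (wi n))"
    using well_labelled_brackets[OF n2c wi \<open>q > 0\<close> ci lab(2)] by blast
  have "first_change p n wo fo" "first_change q n wi fi"
    using wo wi fo(1-4) fi(1-4) unfolding first_change_def cyclic_labels_def by blast+
  moreover have "verts Q = Outer ` {1..p} \<union> Middle ` {1..n} \<union> Inner ` {1..q}"
    by (simp add: Q web_quiver_def)
  ultimately have "three_circles Q p n q wo wi fo fi"
    using pq n2c co ci by unfold_locales (simp_all add: b)
  then show thesis using that fo(5,6) fi(5,6) by blast
qed

theorem theorem6p3: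
  fixes Q :: "web_vertex quiver" and n :: nat
  assumes "spider_web_quiver n Q"
  shows "\<forall>i\<in>{1..n}. cvar (tau n (initial_seed Q)) (Middle i) = X (Middle i) * xbar n Q X"
proof -
  obtain p q wo wi fo fi where c: "three_circles Q p n q wo wi fo fi"
    and br: "\<And>(x :: web_vertex \<Rightarrow> ratfun) j. j \<in> {1..n} \<Longrightarrow> x_br_star n Q x Outer j = x (Outer (wo j))"
    "\<And>(x :: web_vertex \<Rightarrow> ratfun) j. j \<in> {1..n} \<Longrightarrow> x_br_star n Q x Inner j = x (Inner (wi j))"
    "\<And>x :: web_vertex \<Rightarrow> ratfun. x_br Q x Outer n = x (Outer (wo n))"
    "\<And>x :: web_vertex \<Rightarrow> ratfun. x_br Q x Inner n = x (Inner (wi n))"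
    using spider_web_three_circles[OF assms, where ?'f = ratfun] by blast
  interpret three_circles Q p n q wo wi fo fi by (rule c)
  interpret positive_cone sub_free by (rule positive_cone_sub_free)
  interpret three_circles_seed Q p n q wo wi fo fi sub_free X
    by unfold_locales (rule X_in_sub_free)
  show ?thesis
    using tau_middle xbar_eq_Y[OF br] by (simp add: initial_seed_def)
qed

end
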